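(* Let $f\in\mathbf{B}_{k,n}$ and $P\in\mathcal{P}_{k,n}$. Suppose $\overline f=(a^{(1)}_1\cdots a^{(1)}_{n_1})(a^{(2)}_1\cdots a^{(2)}_{n_2})\cdots(a^{(r)}_1\cdots a^{(r)}_{n_r})$ is the cycle decomposition of $\overline f\in S_n$ (cycles of length $1$ included). For each $j\in[r]$ let $S_j\subset\mathbb{Z}$ be the set of all integers congruent modulo $n$ to one of $a^{(j)}_1,\dots,a^{(j)}_{n_j}$, let $f_j:=f|_{S_j}$ be the restriction of $f$ to $S_j$, viewed as an $n_j$-periodic affine permutation via the order-preserving identification $S_j\cong\mathbb{Z}$, let $P_j:=P|_{S_j}$ be the path obtained by restricting $P$ to the steps indexed by $S_j$, and let $k_j:=\operatorname{av}(f_j)$. Then $f_j\in\mathbf{B}_{k_j,n_j}$ for every $j\in[r]$, and: (1) if $P_j\notin\mathcal{P}_{k_j,n_j}$ for some $j\in[r]$, then $\operatorname{Deo}^{\max}_{f,P}=\varnothing$; (2) otherwise, there is a bijection $\operatorname{Deo}^{\max}_{f,P}\longrightarrow\prod_{j=1}^r\operatorname{Deo}^{\max}_{f_j,P_j}$.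
   Context: Let $n\ge 1$, $0\le k\le n$, $[n]=\{1,\dots,n\}$. An $n$-periodic affine permutation is a bijection $f:\mathbb{Z}\to\mathbb{Z}$ with $f(i+n)=f(i)+n$ for all $i$; put $\operatorname{av}(f)=\frac1n\sum_{i=1}^n(f(i)-i)$. $\mathbf{B}_{k,n}$ is the set of $n$-periodic affine permutations with $\operatorname{av}(f)=k$ and $i\le f(i)\le i+n$ for all $i$. $\overline f\in S_n$ is $f$ reduced modulo $n$, and $c(\overline f)$ is its number of cycles (fixed points included). Restriction: each $S_j$ is stable under $f$ and under translation by $n$; it is identified with $\mathbb{Z}$ by the order-preserving bijection sending $\min(S_j\cap\mathbb{Z}_{\ge1})$ to $1$. $P_j$ is the lattice path with $n_j$ steps obtained by keeping, in order, the steps of $P$ with indices in $S_j\cap[n]$. Lattice paths: $\mathcal{P}_{k,n}$ is the set of lattice paths $P$ from $(0,0)$ to $(n-k,k)$ with unit steps $P_1,\dots,P_n\in\{\mathrm R,\mathrm U\}$ (right, up). Extend $P$ to a bi-infinite path with steps indexed by $\mathbb{Z}$ via $P_{i+n}=P_i$ (step $1$ starts at $(0,0)$); it is invariant under translation by $(n-k,k)$. The strip of $P$ is the region between the extended path $P$ (southern boundary) and its translate $P+(0,k)$ (northern boundary). On each boundary the unit edges are labeled by $\mathbb{Z}$: the southern edge labeled $i$ is step $i$ of $P$, and the northern edge labeled $i$ is its translate by $(0,k)$. Fillings: a periodic filling assigns to each unit box of the strip a crossing or an elbow, invariantly under translation by $(n-k,k)$. Strands enter at the northern boundary edges and travel right/down: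 in a crossing box a strand entering from the left exits right and one entering from the top exits at the bottom; in an elbow box a strand entering from the left exits at the bottom and one entering from the top exits right. Each strand ends at a southern boundary edge; the strand permutation sends $i$ to $j$ if the strand entering at northern edge $i$ exits at southern edge $j$. (If $k\in\{0,n\}$ the strip has no boxes, the two boundaries coincide, and each strand exits at the edge where it enters.) An $(f,P)$-affine Deogram is a periodic filling such that (a) its strand permutation is $f$, and (b) (distinguished) whenever two strands form an elbow in a box, they have crossed each other an even number of times in boxes they traversed before it (counting from the northern boundary). $\operatorname{Deo}^{\max}_{f,P}$ is the set of maximal ones: those having exactly $n-c(\overline f)$ elbows modulo translation by $(n-k,k)$. *)

theory Defs
  imports Complex_Main "HOL-Library.FuncSet" "HOL-Combinatorics.Cycles" "HOL-Combinatorics.Orbits"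
begin

section \<open>Periodic affine permutations\<close>

definition affine_perm :: "nat \<Rightarrow> (int \<Rightarrow> int) \<Rightarrow> bool" where
  "affine_perm n f \<longleftrightarrow> bij f \<and> (\<forall>i. f (i + int n) = f i + int n)"

definition av :: "nat \<Rightarrow> (int \<Rightarrow> int) \<Rightarrow> real" where
  "av n f = (\<Sum>i = 1..int n. real_of_int (f i - i)) / real n"

definition bounded_affine_perms :: "nat \<Rightarrow> nat \<Rightarrow> (int \<Rightarrow> int) set" where
  "bounded_affine_perms k n =
     {f. affine_perm n f \<and> av n f = real k \<and> (\<forall>i. i \<le> f i \<and> f i \<le> i + int n)}"

text \<open>The reduction modulo \<open>n\<close>, with \<open>{1..n}\<close> as residue system, extended by the identity outside
  \<open>{1..n}\<close> as usual for \<^const>\<open>permutes\<close>.\<close>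

definition reduction :: "nat \<Rightarrow> (int \<Rightarrow> int) \<Rightarrow> int \<Rightarrow> int" where
  "reduction n f i = (if i \<in> {1..int n} then (f i - 1) mod int n + 1 else i)"

definition num_cycles :: "nat \<Rightarrow> (int \<Rightarrow> int) \<Rightarrow> nat" where
  "num_cycles n g = card (orbit g ` {1..int n})"

text \<open>The permutation \<open>g\<close> of \<open>{1..n}\<close> is the product of the disjoint cycles listed in \<open>cs\<close>.
  Note that \<open>cycle_of_list [a]\<close> is the identity, so that cycles of length 1 have to be forced
  by the condition on \<open>set (concat cs)\<close>.\<close>

definition is_cycle_decomposition :: "nat \<Rightarrow> (int \<Rightarrow> int) \<Rightarrow> int list list \<Rightarrow> bool" where
  "is_cycle_decomposition n g cs \<longleftrightarrow>
     (\<forall>c \<in> set cs. c \<noteq> []) \<and> distinct (concat cs) \<and> set (concat cs) = {1..int n} \<and>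
     g = foldr (\<circ>) (map cycle_of_list cs) id"


section \<open>Lattice paths\<close>

datatype step = StepR | StepU

definition lattice_paths :: "nat \<Rightarrow> nat \<Rightarrow> step list set" where
  "lattice_paths k n = {P. length P = n \<and> count_list P StepU = k}"

text \<open>Step \<open>i\<close> of the extended path; step \<open>i \<in> {1..n}\<close> is the list entry with 0-based index \<open>i - 1\<close>.\<close>

definition path_step :: "step list \<Rightarrow> int \<Rightarrow> step" where
  "path_step P i = P ! nat ((i - 1) mod int (length P))"

text \<open>\<open>(path_x P i, path_y P i)\<close> is the point where step \<open>i\<close> ends and step \<open>i + 1\<close> starts; it is
  \<open>(0, 0)\<close> for \<open>i = 0\<close>. For negative \<open>i\<close> the steps \<open>i + 1, \<dots>, 0\<close> are walked backwards.\<close>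

definition path_coord :: "step \<Rightarrow> step list \<Rightarrow> int \<Rightarrow> int" where
  "path_coord s P i =
     int (card {j \<in> {0<..i}. path_step P j = s}) - int (card {j \<in> {i<..0}. path_step P j = s})"

definition path_x :: "step list \<Rightarrow> int \<Rightarrow> int" where "path_x = path_coord StepR"
definition path_y :: "step list \<Rightarrow> int \<Rightarrow> int" where "path_y = path_coord StepU"

text \<open>For \<open>P \<in> lattice_paths k n\<close> these are \<open>k\<close> and \<open>n - k\<close>, the translation period being
  \<open>(width P, height P)\<close>.\<close>

definition height :: "step list \<Rightarrow> int" where "height P = int (count_list P StepU)"
definition width :: "step list \<Rightarrow> int" where "width P = int (count_list P StepR)"


section \<open>Strip, boxes and strands\<close>

text \<open>A unit box is given by its lower left corner. The boxes of the strip in column \<open>a\<close> are those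
  above the unique right step of \<open>P\<close> in that column and below the translate of this step by
  \<open>(0, height P)\<close>.\<close>

definition strip :: "step list \<Rightarrow> (int \<times> int) set" where
  "strip P = {(a, b). \<exists>i. path_step P i = StepR \<and> path_x P (i - 1) = a \<and>
                 path_y P (i - 1) \<le> b \<and> b < path_y P (i - 1) + height P}"

text \<open>A horizontal or vertical unit edge is given by its left, respectively lower, endpoint.\<close>

datatype edge = Hor int int | Ver int int

fun edge_of :: "step \<Rightarrow> int \<Rightarrow> int \<Rightarrow> edge" where
  "edge_of StepR x y = Hor x y"
| "edge_of StepU x y = Ver x y"

definition south_edge :: "step list \<Rightarrow> int \<Rightarrow> edge" where
  "south_edge P i = edge_of (path_step P i) (path_x P (i - 1)) (path_y P (i - 1))"

definition north_edge :: "step list \<Rightarrow> int \<Rightarrow> edge" where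
  "north_edge P i = edge_of (path_step P i) (path_x P (i - 1)) (path_y P (i - 1) + height P)"

datatype tile = Crossing | Elbow

text \<open>Fillings are functions that are \<^const>\<open>undefined\<close> outside the strip, so that different functions
  are different fillings.\<close>

definition periodic_fillings :: "step list \<Rightarrow> (int \<times> int \<Rightarrow> tile) set" where
  "periodic_fillings P =
     {F \<in> strip P \<rightarrow>\<^sub>E UNIV. \<forall>(a, b) \<in> strip P. F (a + width P, b + height P) = F (a, b)}"

text \<open>The box that a strand passing through an edge (rightwards or downwards) is about to enter.\<close>

fun next_box :: "edge \<Rightarrow> int \<times> int" where
  "next_box (Hor x y) = (x, y - 1)"
| "next_box (Ver x y) = (x, y)"

text \<open>The edge through which a strand leaves the box it has entered through the given edge.\<close>

fun through_box :: "tile \<Rightarrow> edge \<Rightarrow> edge" where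
  "through_box Crossing (Hor x y) = Hor x (y - 1)"
| "through_box Crossing (Ver x y) = Ver (x + 1) y"
| "through_box Elbow (Hor x y) = Ver (x + 1) (y - 1)"
| "through_box Elbow (Ver x y) = Hor x y"

text \<open>Once a strand has left the strip, which happens exactly at the southern edges, it is kept at
  its exit edge.\<close>

definition advance :: "step list \<Rightarrow> (int \<times> int \<Rightarrow> tile) \<Rightarrow> edge \<Rightarrow> edge" where
  "advance P F e = (if next_box e \<in> strip P then through_box (F (next_box e)) e else e)"

definition strand :: "step list \<Rightarrow> (int \<times> int \<Rightarrow> tile) \<Rightarrow> int \<Rightarrow> nat \<Rightarrow> edge" where
  "strand P F i t = (advance P F ^^ t) (north_edge P i)"

definition strand_exits_at :: "step list \<Rightarrow> (int \<times> int \<Rightarrow> tile) \<Rightarrow> int \<Rightarrow> int \<Rightarrow> bool" where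
  "strand_exits_at P F i j \<longleftrightarrow> (\<exists>t. strand P F i t = south_edge P j)"

definition has_strand_perm :: "step list \<Rightarrow> (int \<times> int \<Rightarrow> tile) \<Rightarrow> (int \<Rightarrow> int) \<Rightarrow> bool" where
  "has_strand_perm P F f \<longleftrightarrow> (\<forall>i. strand_exits_at P F i (f i))"

text \<open>The boxes of the strip traversed by strand \<open>i\<close> before the one entered in its \<open>t\<close>-th position
  (counting from 0).\<close>

definition boxes_before :: "step list \<Rightarrow> (int \<times> int \<Rightarrow> tile) \<Rightarrow> int \<Rightarrow> nat \<Rightarrow> (int \<times> int) set" where
  "boxes_before P F i t = {next_box (strand P F i s) | s. s < t} \<inter> strip P"

text \<open>Strands are indexed by \<open>\<int>\<close> (not modulo the period). Two different strands traversing the same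
  box enter it from different sides, hence cross there or form an elbow there, depending on its
  tile.\<close>

definition distinguished :: "step list \<Rightarrow> (int \<times> int \<Rightarrow> tile) \<Rightarrow> bool" where
  "distinguished P F \<longleftrightarrow>
     (\<forall>i j s t B. i \<noteq> j \<and> B \<in> strip P \<and> F B = Elbow \<and>
        next_box (strand P F i s) = B \<and> next_box (strand P F j t) = B \<longrightarrow>
        even (card {C \<in> boxes_before P F i s \<inter> boxes_before P F j t. F C = Crossing}))"


section \<open>Affine Deograms\<close>

definition affine_Deograms :: "(int \<Rightarrow> int) \<Rightarrow> step list \<Rightarrow> (int \<times> int \<Rightarrow> tile) set" where
  "affine_Deograms f P =
     {F \<in> periodic_fillings P. has_strand_perm P F f \<and> distinguished P F}"

definition translation_rel :: "step list \<Rightarrow> ((int \<times> int) \<times> (int \<times> int)) set" where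
  "translation_rel P =
     {((a, b), (a', b')). \<exists>m. a' = a + m * width P \<and> b' = b + m * height P}"

definition num_elbows :: "step list \<Rightarrow> (int \<times> int \<Rightarrow> tile) \<Rightarrow> nat" where
  "num_elbows P F = card ({B \<in> strip P. F B = Elbow} // translation_rel P)"

definition Deo_max :: "(int \<Rightarrow> int) \<Rightarrow> step list \<Rightarrow> (int \<times> int \<Rightarrow> tile) set" where
  "Deo_max f P =
     {F \<in> affine_Deograms f P.
        num_elbows P F = length P - num_cycles (length P) (reduction (length P) f)}"


section \<open>Restriction to the cycles\<close>

definition residue_lift :: "nat \<Rightarrow> int list \<Rightarrow> int set" where
  "residue_lift n c = {i. \<exists>a \<in> set c. i mod int n = a mod int n}"

definition order_index :: "int set \<Rightarrow> int \<Rightarrow> int" where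
  "order_index S = (THE \<phi>. strict_mono \<phi> \<and> range \<phi> = S \<and> \<phi> 1 = (LEAST i. i \<in> S \<and> 1 \<le> i))"

definition restrict_perm :: "int set \<Rightarrow> (int \<Rightarrow> int) \<Rightarrow> int \<Rightarrow> int" where
  "restrict_perm S f = inv (order_index S) \<circ> f \<circ> order_index S"

definition restrict_path :: "int set \<Rightarrow> step list \<Rightarrow> step list" where
  "restrict_path S P = nths P {i. int i + 1 \<in> S}"

end

theory Submission
  imports Defs
begin

text \<open>Call the column of the right step \<open>i\<close> and the row of the up step \<open>i\<close> the line \<open>i\<close> modulo \<open>n\<close>. A strand
  changes its line only at an elbow, and both edges labeled \<open>i\<close> lie on line \<open>i\<close>. So the equivalence relation
  on lines modulo \<open>n\<close> that is generated by the elbows is coarser than the cycles of the reduction of \<open>f\<close>, and as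
  every elbow merges at most two classes, there are at least \<open>n - c\<close> elbows. With exactly \<open>n - c\<close> elbows, the
  classes are the cycles: each elbow lies in a box whose row and column belong to the same \<open>S j\<close>. The boxes
  with both lines in \<open>S j\<close> form the strip of \<open>P j\<close>, and strands with labels in \<open>S j\<close> only cross all other lines. Hence
  a maximal filling amounts to one filling of each of these strips, with the same strands and the same crossings
  between strands of the same class. The elbow counts split because \<open>n - r\<close> is the sum of the lower bounds
  \<open>n j - 1\<close>. Finally, summing the displacements of the strands shows that a strand permutation of a path with
  \<open>k\<close> up steps has average displacement \<open>k\<close>, which leaves no filling if some \<open>P j\<close> has the wrong height.\<close>

section \<open>Strands as a process on pairs of lines\<close>

text \<open>Planar coordinates do not restrict well: deleting the lines outside \<open>S j\<close>
  moves the boxes, and the times at which a strand meets them change too. Labels of lines survive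
  restriction up to an increasing re-indexing, so everything is first rewritten for pairs of labels.
  Restricting a filling is then taking a preimage, and being traversed earlier has to be expressed
  by the order of pairs instead of time. Ticking past parallel lines as well keeps all strands in
  step: at time \<open>t\<close> each of them has gap \<open>n - t\<close>, and every valid state
  with this gap is attained by exactly one strand. So at each time exactly one strand modulo the
  period runs along each row, that is \<open>k\<close> strands out of \<open>n\<close>. The label
  \<open>i\<close> of a strand grows exactly at the ticks after which it runs right, and summing
  over \<open>n\<close> ticks gives the total displacement \<open>n * k\<close>. Distinguishedness
  splits because two strands that meet in a box occupy its two lines: an elbow forces both strands
  into the class of its box, and two strands of one class meet only in boxes of this class.\<close>

type_synonym state = "step \<times> int \<times> int"

text \<open>The pair \<open>(i, j)\<close> stands for the box in the column of the right step \<open>i\<close> and the row of the up step \<open>j\<close>;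
  it lies in the strip if step \<open>j\<close> comes after step \<open>i\<close>, but within one period.\<close>

definition path_boxes :: "(int \<Rightarrow> step) \<Rightarrow> nat \<Rightarrow> (int \<times> int) set" where
  "path_boxes p n = {(i, j). p i = StepR \<and> p j = StepU \<and> i < j \<and> j < i + int n}"

definition elbow_sets :: "(int \<Rightarrow> step) \<Rightarrow> nat \<Rightarrow> (int \<times> int) set set" where
  "elbow_sets p n = {E. E \<subseteq> path_boxes p n \<and> (\<forall>i j. (i + int n, j + int n) \<in> E \<longleftrightarrow> (i, j) \<in> E)}"

text \<open>In the state \<open>(StepR, i, j)\<close> a strand runs down the column of step \<open>i\<close>, facing line \<open>j\<close>; in the state
  \<open>(StepU, i, j)\<close> it runs right along the row of step \<open>j\<close>, facing line \<open>i\<close>. A line that is parallel to the strand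
  is passed without any motion in the plane. So every tick lowers \<open>j - i\<close> by one, a crossing is the same as a
  passed line, and a strand started at \<open>j = i + n\<close> leaves the strip at line \<open>i = j\<close> after \<open>n\<close> ticks.\<close>

definition tick :: "(int \<times> int) set \<Rightarrow> state \<Rightarrow> state" where
  "tick E = (\<lambda>(d, i, j). if (d = StepR) = ((i, j) \<notin> E) then (StepR, i, j - 1) else (StepU, i + 1, j))"

text \<open>The northern edge labeled \<open>s\<close> is one period away from the southern one on
  the same line, hence the pair \<open>(s, s + n)\<close>. The direction is \<open>p s\<close>
  because a horizontal edge is entered downwards and a vertical one rightwards.\<close>

definition traj :: "(int \<Rightarrow> step) \<Rightarrow> nat \<Rightarrow> (int \<times> int) set \<Rightarrow> int \<Rightarrow> nat \<Rightarrow> state" where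
  "traj p n E s t = (tick E ^^ t) (p s, s, s + int n)"

text \<open>Only the line along which the strand runs is tied to the direction; the line it faces
  may be of either type, since parallel lines are passed too.\<close>

definition valid_state :: "(int \<Rightarrow> step) \<Rightarrow> state \<Rightarrow> bool" where
  "valid_state p = (\<lambda>(d, i, j). if d = StepR then p i = StepR else p j = StepU)"

definition visits :: "(int \<Rightarrow> step) \<Rightarrow> nat \<Rightarrow> (int \<times> int) set \<Rightarrow> int \<Rightarrow> (int \<times> int) set" where
  "visits p n E s = range (snd \<circ> traj p n E s) \<inter> path_boxes p n"

definition exits :: "(int \<Rightarrow> step) \<Rightarrow> nat \<Rightarrow> (int \<times> int) set \<Rightarrow> int \<Rightarrow> int \<Rightarrow> bool" where
  "exits p n E s x \<longleftrightarrow> (x, x) \<in> range (snd \<circ> traj p n E s)"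

text \<open>Along a strand \<open>i\<close> only grows and \<open>j\<close> only falls, so
  \<open>a \<le> i \<and> j \<le> b\<close> says that \<open>(a, b)\<close> comes no later than
  \<open>(i, j)\<close>. The pair \<open>(i, j)\<close> itself is an elbow and drops out with
  \<open>E\<close>.\<close>

definition distinguished_set :: "(int \<Rightarrow> step) \<Rightarrow> nat \<Rightarrow> (int \<times> int) set \<Rightarrow> bool" where
  "distinguished_set p n E \<longleftrightarrow>
     (\<forall>s s' i j. s \<noteq> s' \<and> (i, j) \<in> E \<inter> visits p n E s \<inter> visits p n E s' \<longrightarrow>
        even (card {(a, b) \<in> visits p n E s \<inter> visits p n E s' - E. a \<le> i \<and> j \<le> b}))"

text \<open>Translation by a period adds \<open>n\<close> to both labels, so bounding the column
  label selects one elbow from each translation class.\<close>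

definition fundamental_elbows :: "nat \<Rightarrow> (int \<times> int) set \<Rightarrow> (int \<times> int) set" where
  "fundamental_elbows n E = {(i, j) \<in> E. 1 \<le> i \<and> i \<le> int n}"

definition maximal_elbow_sets :: "(int \<Rightarrow> int) \<Rightarrow> (int \<Rightarrow> step) \<Rightarrow> nat \<Rightarrow> (int \<times> int) set set" where
  "maximal_elbow_sets f p n =
     {E \<in> elbow_sets p n. (\<forall>s. exits p n E s (f s)) \<and> distinguished_set p n E \<and>
        card (fundamental_elbows n E) = n - num_cycles n (reduction n f)}"

lemma step_neq_iff [simp]: "d \<noteq> StepR \<longleftrightarrow> d = StepU" "d \<noteq> StepU \<longleftrightarrow> d = StepR"
  by (cases d; simp)+

lemma traj_0 [simp]: "traj p n E s 0 = (p s, s, s + int n)"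
  by (simp add: traj_def)

lemma traj_Suc [simp]: "traj p n E s (Suc t) = tick E (traj p n E s t)"
  by (simp add: traj_def)

lemma traj_gap:
  assumes "traj p n E s t = (d, i, j)"
  shows "j - i = int n - int t"
  using assms
proof (induction t arbitrary: d i j)
  case (Suc t)
  obtain d' i' j' where *: "traj p n E s t = (d', i', j')" by (metis prod_cases3)
  with Suc show ?case by (fastforce simp: tick_def split: if_splits)
qed auto

text \<open>The direction after a tick tells which label has moved, hence the old pair; membership
  of that pair in \<open>E\<close> then tells the old direction.\<close>

lemma inj_tick: "inj (tick E)"
  by (rule injI) (auto simp: tick_def split: if_splits prod.splits)

text \<open>The gap of a state reveals its time, so a common state of two strands forces equal
  times, and then the ticks can be undone.\<close>

lemma traj_inj:
  assumes "traj p n E s t = traj p n E s' t'"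
  shows "s = s'" and "t = t'"
proof -
  obtain d i j where *: "traj p n E s t = (d, i, j)" by (metis prod_cases3)
  from traj_gap[OF *] traj_gap[of p n E s' t' d i j] assms * show "t = t'" by simp
  with assms have "(tick E ^^ t) (p s, s, s + int n) = (tick E ^^ t) (p s', s', s' + int n)"
    by (simp add: traj_def)
  with inj_fn[OF inj_tick, of t E] show "s = s'" by (auto dest: injD)
qed

lemma traj_mono:
  assumes "traj p n E s t = (d, i, j)" "traj p n E s t' = (d', i', j')" "t \<le> t'"
  shows "i \<le> i' \<and> j' \<le> j"
  using assms(3,2)
proof (induction arbitrary: d' i' j' rule: dec_induct)
  case base
  with assms(1) show ?case by simp
next
  case (step m)
  obtain d'' i'' j'' where *: "traj p n E s m = (d'', i'', j'')" by (metis prod_cases3)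
  from step.IH[OF *] step.prems * show ?case by (auto simp: tick_def split: if_splits)
qed

text \<open>A trajectory is a chain of pairs with strictly falling gap. This is what allows
  \<open>distinguished_set\<close> to avoid times.\<close>

lemma traj_before_iff:
  assumes "traj p n E s t = (d, i, j)" "traj p n E s t' = (d', i', j')"
  shows "t' < t \<longleftrightarrow> i' \<le> i \<and> j \<le> j' \<and> (i', j') \<noteq> (i, j)"
  using traj_gap[OF assms(1)] traj_gap[OF assms(2)] traj_mono[OF assms(1,2)] traj_mono[OF assms(2,1)]
  by (cases "t \<le> t'") auto

lemma traj_valid:
  assumes "E \<subseteq> path_boxes p n" "\<And>i. p (i + int n) = p i"
  shows "valid_state p (traj p n E s t)"
proof (induction t)
  case 0
  show ?case using assms(2) by (cases "p s") (auto simp: valid_state_def)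
next
  case (Suc t)
  obtain d i j where *: "traj p n E s t = (d, i, j)" by (metis prod_cases3)
  with Suc assms(1) show ?case
    by (auto simp: valid_state_def tick_def path_boxes_def split: if_splits)
qed

lemma traj_end:
  obtains d x where "traj p n E s n = (d, x, x)"
proof -
  obtain d i j where *: "traj p n E s n = (d, i, j)" by (metis prod_cases3)
  with traj_gap[OF this] that show thesis by auto
qed

lemma visitsE:
  assumes "(i, j) \<in> visits p n E s"
  obtains d t where "traj p n E s t = (d, i, j)"
  using assms by (auto simp: visits_def) (metis prod.collapse)

lemma visitsI: "traj p n E s t = (d, i, j) \<Longrightarrow> (i, j) \<in> path_boxes p n \<Longrightarrow> (i, j) \<in> visits p n E s"
  by (auto simp: visits_def intro!: image_eqI[of _ _ t])

lemma in_range_traj: "(x, y) \<in> range (snd \<circ> traj p n E s) \<longleftrightarrow> (\<exists>d t. traj p n E s t = (d, x, y))"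
proof
  assume "(x, y) \<in> range (snd \<circ> traj p n E s)"
  then obtain t where "snd (traj p n E s t) = (x, y)" by auto
  then show "\<exists>d t. traj p n E s t = (d, x, y)" by (metis prod.collapse)
next
  assume "\<exists>d t. traj p n E s t = (d, x, y)"
  then obtain d t where "traj p n E s t = (d, x, y)" by blast
  then show "(x, y) \<in> range (snd \<circ> traj p n E s)" by (intro image_eqI[of _ _ t]) simp_all
qed

lemma exits_iff: "exits p n E s x \<longleftrightarrow> snd (traj p n E s n) = (x, x)"
proof
  assume "exits p n E s x"
  then obtain t where t: "snd (traj p n E s t) = (x, x)" by (auto simp: exits_def)
  then obtain d where d: "traj p n E s t = (d, x, x)" by (metis prod.collapse)
  from traj_gap[OF d] t show "snd (traj p n E s n) = (x, x)" by simp
next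
  assume "snd (traj p n E s n) = (x, x)"
  then show "exits p n E s x" unfolding exits_def by (intro image_eqI[of _ _ n]) simp_all
qed

text \<open>An elbow moves a strand between two lines of the same class, so strands stay in their class.\<close>

lemma traj_class:
  assumes "\<And>i. q (i + int n) = q i" "\<And>i j. (i, j) \<in> E \<Longrightarrow> q i = q j"
    "traj p n E s t = (d, i, j)"
  shows "q (if d = StepR then i else j) = q s"
  using assms(3)
proof (induction t arbitrary: d i j)
  case 0
  then show ?case using assms(1) by auto
next
  case (Suc t)
  obtain d' i' j' where *: "traj p n E s t = (d', i', j')" by (metis prod_cases3)
  from Suc.IH[OF *] Suc.prems * assms(2)[of i' j'] show ?case
    by (auto simp: tick_def split: if_splits)
qed

lemma exits_class:
  assumes "\<And>i. q (i + int n) = q i" "\<And>i j. (i, j) \<in> E \<Longrightarrow> q i = q j" "exits p n E s x"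
  shows "q x = q s"
proof -
  from assms(3) obtain d where "traj p n E s n = (d, x, x)"
    by (metis exits_iff prod.collapse)
  from traj_class[where q = q, OF assms(1,2) this] show ?thesis by simp
qed

text \<open>Two different strands in a box travel in different directions.\<close>

lemma visits_two_class:
  assumes "\<And>i. q (i + int n) = q i" "\<And>i j. (i, j) \<in> E \<Longrightarrow> q i = q j" "s \<noteq> s'"
    "(i, j) \<in> visits p n E s" "(i, j) \<in> visits p n E s'"
  shows "q i = q s \<and> q j = q s' \<or> q i = q s' \<and> q j = q s"
proof -
  obtain d t where d: "traj p n E s t = (d, i, j)" using assms(4) by (rule visitsE)
  obtain d' t' where d': "traj p n E s' t' = (d', i, j)" using assms(5) by (rule visitsE)
  with traj_gap[OF d] traj_gap[OF d'] d traj_inj[of p n E s t s' t'] assms(3) have "d \<noteq> d'" by auto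
  with traj_class[where q = q, OF assms(1,2) d] traj_class[where q = q, OF assms(1,2) d'] show ?thesis
    by (cases d; cases d') auto
qed


section \<open>Boxes of the strip as pairs of lines\<close>

lemma path_coord_step:
  "path_coord s P i = path_coord s P (i - 1) + (if path_step P i = s then 1 else 0)"
proof -
  have insert: "card {j \<in> insert i A. path_step P j = s} =
      card {j \<in> A. path_step P j = s} + (if path_step P i = s then 1 else 0)"
    if "finite A" "i \<notin> A" for A
  proof -
    have "{j \<in> insert i A. path_step P j = s} =
        (if path_step P i = s then insert i else id) {j \<in> A. path_step P j = s}"
      by auto
    with that show ?thesis by simp
  qed
  show ?thesis
  proof (cases "0 < i")
    case True
    then have "{0<..i} = insert i {0<..i - 1}" by auto
    with insert[of "{0<..i - 1}"] True show ?thesis by (simp add: path_coord_def)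
  next
    case False
    then have "{i - 1<..0} = insert i {i<..0}" by auto
    with insert[of "{i<..0}"] False show ?thesis by (simp add: path_coord_def)
  qed
qed

lemma path_coord_mono: "i \<le> j \<Longrightarrow> path_coord s P i \<le> path_coord s P j"
proof (induction rule: int_ge_induct)
  case (step j)
  with path_coord_step[of s P "j + 1"] show ?case by simp
qed simp

text \<open>The coordinate climbs in unit steps, so it takes the value \<open>b\<close>, and it
  leaves this value at a step of type \<open>s\<close>.\<close>

lemma path_coord_IVT:
  assumes "i \<le> j" "path_coord s P i \<le> b" "b < path_coord s P j"
  obtains m where "i < m" "m \<le> j" "path_step P m = s" "path_coord s P (m - 1) = b"
  using assms
proof (induction arbitrary: thesis rule: int_ge_induct)
  case (step j)
  show ?case
  proof (cases "b < path_coord s P j")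
    case True
    show ?thesis by (rule step.IH[OF _ step.prems(2) True]) (use step.prems(1) in auto)
  next
    case False
    with path_coord_step[of s P "j + 1"] step.prems step.hyps show ?thesis
      by (intro step.prems(1)[of "j + 1"]) (auto split: if_splits)
  qed
qed auto

lemma path_coord_inj:
  assumes "path_step P i = s" "path_step P j = s" "path_coord s P (i - 1) = path_coord s P (j - 1)"
  shows "i = j"
proof -
  have "path_coord s P (a - 1) < path_coord s P (b - 1)" if "a < b" "path_step P a = s" for a b
    using path_coord_step[of s P a] path_coord_mono[of a "b - 1" s P] that by simp
  from this[of i j] this[of j i] assms show ?thesis by (cases i j rule: linorder_cases) auto
qed

lemma path_step_periodic: "path_step P (i + int (length P)) = path_step P i"
  by (metis add_diff_eq add.commute mod_add_self2 path_step_def)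

lemma path_step_Suc: "k < length P \<Longrightarrow> path_step P (int k + 1) = P ! k"
  by (simp add: path_step_def)

lemma path_coord_0: "path_coord s P 0 = 0"
  by (simp add: path_coord_def)

lemma path_coord_length: "path_coord s P (int (length P)) = int (count_list P s)"
proof -
  have "bij_betw (\<lambda>k. int k + 1) {k. k < length P \<and> P ! k = s} {j \<in> {0<..int (length P)}. path_step P j = s}"
    by (rule bij_betwI[where g = "\<lambda>j. nat (j - 1)"])
       (auto simp: path_step_Suc, auto simp: path_step_def)
  from bij_betw_same_card[OF this] show ?thesis
    by (simp add: path_coord_def count_list_eq_length_filter length_filter_conv_card eq_commute[of s])
qed

lemma path_coord_periodic:
  "path_coord s P (i + int (length P)) = path_coord s P i + int (count_list P s)"
proof (induction i rule: int_induct[where k = 0])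
  case base
  show ?case by (simp add: path_coord_length path_coord_0)
next
  case (step1 i)
  have "i + 1 + int (length P) - 1 = i + int (length P)" by simp
  with step1 show ?case
    using path_coord_step[of s P "i + 1"] path_coord_step[of s P "i + 1 + int (length P)"]
      path_step_periodic[of P "i + 1"] by simp
next
  case (step2 i)
  have "i + int (length P) - 1 = i - 1 + int (length P)" by simp
  with step2 show ?case
    using path_coord_step[of s P i] path_coord_step[of s P "i + int (length P)"]
      path_step_periodic[of P i] by simp
qed

lemmas path_x_step = path_coord_step[of StepR, folded path_x_def]
  and path_y_step = path_coord_step[of StepU, folded path_y_def]
  and path_x_periodic = path_coord_periodic[of StepR, folded path_x_def, folded width_def]
  and path_y_periodic = path_coord_periodic[of StepU, folded path_y_def, folded height_def]
  and path_x_mono = path_coord_mono[of _ _ StepR, folded path_x_def]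
  and path_y_mono = path_coord_mono[of _ _ StepU, folded path_y_def]
  and path_x_inj = path_coord_inj[of _ _ StepR, folded path_x_def]
  and path_y_inj = path_coord_inj[of _ _ StepU, folded path_y_def]

section \<open>Boxes of the strip and periodic fillings\<close>

definition box_at :: "step list \<Rightarrow> int \<times> int \<Rightarrow> int \<times> int" where
  "box_at P = (\<lambda>(i, j). (path_x P (i - 1), path_y P (j - 1)))"

text \<open>In the column of the right step \<open>i\<close> the boxes fill one period of heights
  above the path, and each of these heights is the level of one up step \<open>j\<close> with
  \<open>i < j < i + n\<close>.\<close>

lemma strip_eq: "strip P = box_at P ` path_boxes (path_step P) (length P)" (is "_ = _ ` ?B")
proof (intro equalityI subsetI)
  fix B assume "B \<in> strip P"
  then obtain i b where *: "path_step P i = StepR" "path_y P (i - 1) \<le> b"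
    "b < path_y P (i - 1) + height P" "B = (path_x P (i - 1), b)"
    by (auto simp: strip_def)
  \<comment> \<open>Over one period the path rises by \<open>height P\<close>, so the level
    \<open>b\<close> is left by an up step within this period.\<close>
  have "b < path_y P (i - 1 + int (length P))" using *(3) by (simp only: path_y_periodic)
  with *(2) obtain j where j: "i - 1 < j" "j \<le> i - 1 + int (length P)" "path_step P j = StepU"
      "path_y P (j - 1) = b"
    by (elim path_coord_IVT[of "i - 1" "i - 1 + int (length P)" StepU P b, folded path_y_def, rotated]) simp_all
  with * show "B \<in> box_at P ` ?B"
    by (cases "i = j") (auto simp: box_at_def path_boxes_def intro!: image_eqI[of _ _ "(i, j)"])
next
  fix B assume "B \<in> box_at P ` ?B"
  then obtain i j where *: "path_step P i = StepR" "path_step P j = StepU" "i < j"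
    "j < i + int (length P)" "B = (path_x P (i - 1), path_y P (j - 1))"
    by (auto simp: box_at_def path_boxes_def)
  then have "path_y P (i - 1) \<le> path_y P (j - 1)" "path_y P j \<le> path_y P (i - 1) + height P"
    using path_y_mono[of "i - 1" "j - 1" P] path_y_mono[of j "i - 1 + int (length P)" P]
    by (simp_all add: path_y_periodic)
  with * path_y_step[of P j] show "B \<in> strip P" by (auto simp: strip_def)
qed

lemma inj_on_box_at: "inj_on (box_at P) (path_boxes (path_step P) n)"
  by (auto simp: inj_on_def box_at_def path_boxes_def dest: path_x_inj path_y_inj)

lemma box_at_shift:
  "box_at P (i + int (length P), j + int (length P)) =
     (fst (box_at P (i, j)) + width P, snd (box_at P (i, j)) + height P)"
  using path_x_periodic[of P "i - 1"] path_y_periodic[of P "j - 1"]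
  by (simp add: box_at_def algebra_simps)

lemma box_at_shifts:
  "box_at P (i + m * int (length P), j + m * int (length P)) =
     (fst (box_at P (i, j)) + m * width P, snd (box_at P (i, j)) + m * height P)"
proof (induction m rule: int_induct[where k = 0])
  case (step1 m)
  then show ?case using box_at_shift[of P "i + m * int (length P)" "j + m * int (length P)"]
    by (simp add: algebra_simps)
next
  case (step2 m)
  then show ?case using box_at_shift[of P "i + (m - 1) * int (length P)"
      "j + (m - 1) * int (length P)"]
    by (simp add: algebra_simps)
qed simp

definition elbow_set :: "step list \<Rightarrow> (int \<times> int \<Rightarrow> tile) \<Rightarrow> (int \<times> int) set" where
  "elbow_set P F = {C \<in> path_boxes (path_step P) (length P). F (box_at P C) = Elbow}"

lemma path_boxes_shift:
  assumes "\<And>i. p (i + int n) = p i"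
  shows "(i + int n, j + int n) \<in> path_boxes p n \<longleftrightarrow> (i, j) \<in> path_boxes p n"
  using assms by (auto simp: path_boxes_def)

lemma tile_neq_iff: "c \<noteq> Elbow \<longleftrightarrow> c = Crossing"
  by (cases c) auto

lemma bij_betw_elbow_set:
  "bij_betw (elbow_set P) (periodic_fillings P) (elbow_sets (path_step P) (length P))"
proof -
  let ?B = "path_boxes (path_step P) (length P)" and ?n = "int (length P)"
  \<comment> \<open>Restricted to the strip, hence \<open>undefined\<close> outside like every
    periodic filling; otherwise it could not invert \<open>elbow_set\<close>.\<close>
  define fill where "fill E = (\<lambda>B\<in>strip P. if B \<in> box_at P ` E then Elbow else Crossing)" for E
  have shift: "(i + ?n, j + ?n) \<in> ?B \<longleftrightarrow> (i, j) \<in> ?B" for i j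
    by (rule path_boxes_shift) (rule path_step_periodic)
  have eq: "fill E (box_at P C) = Elbow \<longleftrightarrow> C \<in> E" if "E \<subseteq> ?B" "C \<in> ?B" for C E
  proof -
    have "box_at P C \<in> box_at P ` E \<longleftrightarrow> C \<in> E"
      using that inj_on_box_at[of P "length P"] by (auto simp: inj_on_def)
    with that show ?thesis by (auto simp: fill_def strip_eq)
  qed
  show ?thesis
  proof (rule bij_betwI[where g = fill])
    show "elbow_set P \<in> periodic_fillings P \<rightarrow> elbow_sets (path_step P) (length P)"
    proof
      fix F assume F: "F \<in> periodic_fillings P"
      have "F (box_at P (i + ?n, j + ?n)) = F (box_at P (i, j))" if "(i, j) \<in> ?B" for i j
        using F that by (cases "box_at P (i, j)") (force simp: periodic_fillings_def box_at_shift strip_eq)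
      then show "elbow_set P F \<in> elbow_sets (path_step P) (length P)"
        by (auto simp: elbow_set_def elbow_sets_def shift)
    qed
    show "fill \<in> elbow_sets (path_step P) (length P) \<rightarrow> periodic_fillings P"
    proof
      fix E assume E: "E \<in> elbow_sets (path_step P) (length P)"
      have "fill E (a + width P, b + height P) = fill E (a, b)" if ab: "(a, b) \<in> strip P" for a b
      proof -
        from ab obtain i j where ij: "(i, j) \<in> ?B" "(a, b) = box_at P (i, j)"
            by (auto simp: strip_eq)
        then have "(a + width P, b + height P) = box_at P (i + ?n, j + ?n)"
          by (simp add: box_at_shift flip: ij(2))
        moreover have "fill E (box_at P (i + ?n, j + ?n)) = Elbow \<longleftrightarrow> fill E (box_at P (i, j)) = Elbow"
          using eq[of E "(i, j)"] eq[of E "(i + ?n, j + ?n)"] E ij(1) shift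
              by (simp add: elbow_sets_def)
        ultimately show ?thesis
          unfolding ij(2) by (cases "fill E (box_at P (i, j))") (auto simp: tile_neq_iff)
      qed
      moreover have "fill E \<in> strip P \<rightarrow>\<^sub>E UNIV" by (simp add: fill_def)
      ultimately show "fill E \<in> periodic_fillings P"
        unfolding periodic_fillings_def by blast
    qed
    fix F assume F: "F \<in> periodic_fillings P"
    show "fill (elbow_set P F) = F"
    proof
      fix B
      show "fill (elbow_set P F) B = F B"
      proof (cases "B \<in> strip P")
        case True
        then obtain C where C: "C \<in> ?B" "B = box_at P C" by (auto simp: strip_eq)
        have "elbow_set P F \<subseteq> ?B" "C \<in> elbow_set P F \<longleftrightarrow> F B = Elbow"
          using C by (auto simp: elbow_set_def)
        with eq[OF this(1) C(1)] C(2) show ?thesis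
          by (cases "F B") (auto simp: tile_neq_iff)
      next
        case False
        with F show ?thesis by (auto simp: fill_def periodic_fillings_def)
      qed
    qed
  next
    fix E assume "E \<in> elbow_sets (path_step P) (length P)"
    then show "elbow_set P (fill E) = E"
      using eq[of E] by (auto simp: elbow_set_def elbow_sets_def)
  qed
qed

text \<open>A strand running down enters a box through its top edge, at the height where the up step
  \<open>j\<close> ends; one running right enters through the left edge, whose lower endpoint has
  the height where step \<open>j\<close> starts. Hence \<open>j\<close> in one case and
  \<open>j - 1\<close> in the other.\<close>

definition edge_at :: "step list \<Rightarrow> state \<Rightarrow> edge" where
  "edge_at P = (\<lambda>(d, i, j). if d = StepR then Hor (path_x P (i - 1)) (path_y P j)
                 else Ver (path_x P (i - 1)) (path_y P (j - 1)))"

lemma next_box_edge_at: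
  assumes "(i, j) \<in> path_boxes (path_step P) (length P)"
  shows "next_box (edge_at P (d, i, j)) = box_at P (i, j)"
  using assms path_y_step[of P j] by (auto simp: edge_at_def box_at_def path_boxes_def)

lemma edge_at_tick_box:
  assumes "(i, j) \<in> path_boxes (path_step P) (length P)"
  shows "edge_at P (tick (elbow_set P F) (d, i, j)) = advance P F (edge_at P (d, i, j))"
proof -
  have "box_at P (i, j) \<in> strip P" using assms by (auto simp: strip_eq)
  moreover have "(i, j) \<in> elbow_set P F \<longleftrightarrow> F (box_at P (i, j)) = Elbow"
    using assms by (simp add: elbow_set_def)
  ultimately show ?thesis
    using assms path_y_step[of P j] path_x_step[of P i]
    by (cases d; cases "F (box_at P (i, j))")
       (auto simp: advance_def next_box_edge_at tick_def, auto simp: edge_at_def path_boxes_def)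
qed

lemma edge_at_tick_pass:
  assumes "(i, j) \<notin> path_boxes (path_step P) (length P)" "valid_state (path_step P) (d, i, j)"
    "i < j" "j \<le> i + int (length P)"
  shows "edge_at P (tick (elbow_set P F) (d, i, j)) = edge_at P (d, i, j)"
proof -
  have "(i, j) \<notin> elbow_set P F" using assms(1) by (simp add: elbow_set_def)
  \<comment> \<open>The faced line is parallel to the strand: for \<open>j = i + n\<close> the two
    lines agree modulo the period, and otherwise two lines of different type would form a
    box.\<close>
  moreover have "path_step P (if d = StepR then j else i) = d"
    using assms path_step_periodic[of P i]
    by (cases "j = i + int (length P)"; cases d) (auto simp: valid_state_def path_boxes_def)
  ultimately show ?thesis
    using path_y_step[of P j] path_x_step[of P i]
    by (cases d) (auto simp: edge_at_def tick_def)
qed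


section \<open>Deograms as elbow sets\<close>

lemma elbow_sets_shift:
  assumes "E \<in> elbow_sets p n"
  shows "(i + m * int n, j + m * int n) \<in> E \<longleftrightarrow> (i, j) \<in> E"
proof (induction m rule: int_induct[where k = 0])
  case (step1 m)
  have "(i + m * int n + int n, j + m * int n + int n) \<in> E \<longleftrightarrow> (i + m * int n, j + m * int n) \<in> E"
    using assms by (simp add: elbow_sets_def)
  with step1 show ?case by (simp add: algebra_simps)
next
  case (step2 m)
  have "(i + (m - 1) * int n + int n, j + (m - 1) * int n + int n) \<in> E
      \<longleftrightarrow> (i + (m - 1) * int n, j + (m - 1) * int n) \<in> E"
    using assms by (simp add: elbow_sets_def)
  with step2 show ?case by (simp add: algebra_simps)
qed simp

definition residue :: "nat \<Rightarrow> int \<Rightarrow> int" where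
  "residue n i = (i - 1) mod int n + 1"

lemma residue_eq: "residue n i = i - (i - 1) div int n * int n"
  by (simp add: residue_def minus_div_mult_eq_mod [symmetric])

lemma residue_in: "0 < n \<Longrightarrow> residue n i \<in> {1..int n}"
  by (simp add: residue_def add1_zle_eq)

lemma residue_id: "i \<in> {1..int n} \<Longrightarrow> residue n i = i"
  by (auto simp: residue_def)

lemma residue_shift: "residue n (i + m * int n) = residue n i"
  by (simp add: residue_def diff_add_eq [symmetric])

lemma eq_if_shift_in:
  assumes "i \<in> {1..int n}" "i + m * int n \<in> {1..int n}"
  shows "m = 0"
  using assms residue_id[of i n] residue_id[of "i + m * int n" n] residue_shift[of n i m] by auto

lemma translation_rel_Image:
  "translation_rel P `` {(a, b)} = {(a + m * width P, b + m * height P) | m. True}"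
  by (auto simp: translation_rel_def)

lemma card_fundamental_elbows:
  assumes "P \<noteq> []" "F \<in> periodic_fillings P"
  shows "card (fundamental_elbows (length P) (elbow_set P F)) = num_elbows P F"
proof -
  let ?n = "length P" and ?E = "elbow_set P F"
  \<comment> \<open>All translates of a box, written through labels: \<open>m\<close> periods of the
    plane are \<open>m * n\<close> in both labels.\<close>
  define orb where "orb i j = {box_at P (i + m * int ?n, j + m * int ?n) | m. True}" for i j
  have E: "?E \<in> elbow_sets (path_step P) ?n"
    using bij_betw_elbow_set[of P] assms(2) by (auto simp: bij_betw_def)
  have n: "0 < ?n" using assms(1) by simp
  have orb: "translation_rel P `` {box_at P (i, j)} = orb i j" for i j
    by (cases "box_at P (i, j)") (simp add: orb_def translation_rel_Image box_at_shifts)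
  have elbows: "{B \<in> strip P. F B = Elbow} = box_at P ` ?E"
    by (auto simp: strip_eq elbow_set_def)
  have orb_shift: "orb (i + m * int ?n) (j + m * int ?n) = orb i j" for i j m
  proof
    show "orb (i + m * int ?n) (j + m * int ?n) \<subseteq> orb i j"
      by (auto simp: orb_def algebra_simps) (metis distrib_right)
    show "orb i j \<subseteq> orb (i + m * int ?n) (j + m * int ?n)"
    proof
      fix B assume "B \<in> orb i j"
      then obtain m' where "B = box_at P (i + m' * int ?n, j + m' * int ?n)" by (auto simp: orb_def)
      then have "B = box_at P (i + m * int ?n + (m' - m) * int ?n, j + m * int ?n + (m' - m) * int ?n)"
        by (simp add: algebra_simps)
      then show "B \<in> orb (i + m * int ?n) (j + m * int ?n)" unfolding orb_def by blast
    qed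
  qed
  have "bij_betw (\<lambda>(i, j). orb i j) (fundamental_elbows ?n ?E) ((box_at P ` ?E) // translation_rel P)"
  proof (rule bij_betw_imageI)
    show "inj_on (\<lambda>(i, j). orb i j) (fundamental_elbows ?n ?E)"
    proof (rule inj_onI, clarify)
      fix i j i' j' assume ij: "(i, j) \<in> fundamental_elbows ?n ?E"
          "(i', j') \<in> fundamental_elbows ?n ?E"
        and "orb i j = orb i' j'"
      moreover have "box_at P (i', j') \<in> orb i' j'" unfolding orb_def by (auto intro: exI[of _ 0])
      ultimately obtain m where m: "box_at P (i', j') = box_at P (i + m * int ?n, j + m * int ?n)"
        by (auto simp: orb_def)
      \<comment> \<open>\<open>box_at\<close> is injective on boxes only, so both pairs have to be
        recognized as elbows first.\<close>
      have "(i', j') = (i + m * int ?n, j + m * int ?n)"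
        by (rule inj_onD[OF inj_on_box_at m])
           (use ij E elbow_sets_shift[OF E, of i m j] in \<open>auto simp: fundamental_elbows_def elbow_set_def\<close>)
      with ij eq_if_shift_in[of i ?n m] show "i = i' \<and> j = j'"
        by (auto simp: fundamental_elbows_def)
    qed
    show "(\<lambda>(i, j). orb i j) ` fundamental_elbows ?n ?E = (box_at P ` ?E) // translation_rel P"
    proof (intro equalityI subsetI)
      fix Q assume "Q \<in> (box_at P ` ?E) // translation_rel P"
      then obtain i j where ij: "(i, j) \<in> ?E" "Q = orb i j" by (auto simp: quotient_def orb)
      define m where "m = - ((i - 1) div int ?n)"
      have "i + m * int ?n \<in> {1..int ?n}"
        using residue_in[OF n, of i] by (simp add: residue_eq m_def)
      with ij elbow_sets_shift[OF E, of i m j] have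
          "(i + m * int ?n, j + m * int ?n) \<in> fundamental_elbows ?n ?E"
        by (simp add: fundamental_elbows_def)
      with ij orb_shift show "Q \<in> (\<lambda>(i, j). orb i j) ` fundamental_elbows ?n ?E"
        by (metis (no_types, lifting) case_prod_conv image_eqI)
    qed (auto simp: quotient_def fundamental_elbows_def simp flip: orb)
  qed
  from bij_betw_same_card[OF this] show ?thesis by (simp add: num_elbows_def elbows)
qed

text \<open>Translates ticks into the time of \<^const>\<open>strand\<close>, which only counts the boxes of the strip.\<close>

definition clock :: "(int \<Rightarrow> step) \<Rightarrow> nat \<Rightarrow> (int \<times> int) set \<Rightarrow> int \<Rightarrow> nat \<Rightarrow> nat" where
  "clock p n E s t = card {t'. t' < t \<and> snd (traj p n E s t') \<in> path_boxes p n}"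

lemma clock_0 [simp]: "clock p n E s 0 = 0"
  by (simp add: clock_def)

lemma clock_Suc [simp]:
  "clock p n E s (Suc t) = (if snd (traj p n E s t) \<in> path_boxes p n then Suc (clock p n E s t) else clock p n E s t)"
proof -
  have "{t'. t' < Suc t \<and> snd (traj p n E s t') \<in> path_boxes p n} =
     (if snd (traj p n E s t) \<in> path_boxes p n then insert t else id) {t'. t' < t \<and> snd (traj p n E s t') \<in> path_boxes p n}"
    by (auto simp: less_Suc_eq)
  then show ?thesis by (simp add: clock_def)
qed

text \<open>The clock advances by one exactly at the ticks inside boxes, so each earlier reading is
  shown at such a tick.\<close>

lemma clock_less:
  assumes "\<sigma> < clock p n E s t"
  obtains t' where "t' < t" "snd (traj p n E s t') \<in> path_boxes p n" "clock p n E s t' = \<sigma>"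
  using assms
proof (induction t arbitrary: thesis)
  case (Suc t)
  show ?case
  proof (cases "\<sigma> < clock p n E s t")
    case True
    from Suc.IH[OF _ True] Suc.prems(1) show thesis by (metis less_Suc_eq)
  next
    case False
    with Suc.prems show thesis by (auto split: if_splits simp: less_Suc_eq)
  qed
qed simp

lemma clock_mono_strict:
  assumes "t' < t" "snd (traj p n E s t') \<in> path_boxes p n"
  shows "clock p n E s t' < clock p n E s t"
  unfolding clock_def by (rule psubset_card_mono) (use assms in auto)

abbreviation "boxes_of P \<equiv> path_boxes (path_step P) (length P)"
abbreviation "traj_of P F \<equiv> traj (path_step P) (length P) (elbow_set P F)"
abbreviation "clock_of P F \<equiv> clock (path_step P) (length P) (elbow_set P F)"
abbreviation "visits_of P F \<equiv> visits (path_step P) (length P) (elbow_set P F)"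

section \<open>Comparison of planar strands with ticking strands\<close>

context
  fixes P :: "step list" and F :: "int \<times> int \<Rightarrow> tile"
begin

lemma elbow_set_subset: "elbow_set P F \<subseteq> boxes_of P"
  by (auto simp: elbow_set_def)

lemma traj_valid_elbow_set: "valid_state (path_step P) (traj_of P F s t)"
  by (rule traj_valid[OF elbow_set_subset path_step_periodic])

text \<open>In a box the clock and the planar strand both advance; at a passed line both stand
  still.\<close>

lemma strand_clock: "t \<le> length P \<Longrightarrow> strand P F s (clock_of P F s t) = edge_at P (traj_of P F s t)"
proof (induction t)
  case 0
  have "path_y P (s + int (length P)) = path_y P s + height P"
    "path_y P (s + int (length P) - 1) = path_y P (s - 1) + height P"
    using path_y_periodic[of P s] path_y_periodic[of P "s - 1"] by (simp_all add: algebra_simps)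
  then show ?case using path_y_step[of P s]
    by (cases "path_step P s") (auto simp: strand_def north_edge_def edge_at_def)
next
  case (Suc t)
  obtain d i j where *: "traj_of P F s t = (d, i, j)" by (metis prod_cases3)
  from traj_gap[OF this] Suc.prems have ij: "i < j" "j \<le> i + int (length P)" by simp_all
  show ?case
  proof (cases "(i, j) \<in> boxes_of P")
    case True
    with Suc * show ?thesis by (simp add: edge_at_tick_box) (simp add: strand_def)
  next
    case False
    with Suc * ij traj_valid_elbow_set[of s t] show ?thesis by (simp add: edge_at_tick_pass)
  qed
qed

text \<open>The box beyond the edge would lie in the column of \<open>x\<close> below the path, or
  in the row of \<open>x\<close> to the right of it. But boxes of the strip pair a right step with a
  later up step.\<close>

lemma south_edge_not_in_strip: "next_box (south_edge P x) \<notin> strip P"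
proof
  assume "next_box (south_edge P x) \<in> strip P"
  then obtain i j where ij: "path_step P i = StepR" "path_step P j = StepU" "i < j"
    "next_box (south_edge P x) = (path_x P (i - 1), path_y P (j - 1))"
    by (auto simp: strip_eq path_boxes_def box_at_def)
  show False
  proof (cases "path_step P x")
    case StepR
    with ij have "x = i" "path_y P (x - 1) - 1 = path_y P (j - 1)"
      by (auto simp: south_edge_def dest: path_x_inj)
    with ij path_y_mono[of "i - 1" "j - 1" P] show False by simp
  next
    case StepU
    with ij have "x = j" "path_x P (x - 1) = path_x P (i - 1)"
      by (auto simp: south_edge_def dest: path_y_inj)
    with ij path_x_mono[of i "j - 1" P] path_x_step[of P i] show False by simp
  qed
qed

lemma south_edge_inj: "south_edge P x = south_edge P y \<Longrightarrow> x = y"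
  by (cases "path_step P x"; cases "path_step P y")
     (auto simp: south_edge_def intro: path_x_inj path_y_inj)

lemma strand_final:
  assumes "traj_of P F s (length P) = (d, x, x)" "clock_of P F s (length P) \<le> \<sigma>"
  shows "strand P F s \<sigma> = south_edge P x"
  using assms(2)
proof (induction rule: dec_induct)
  case base
  from traj_valid_elbow_set[of s "length P"] assms(1) path_y_step[of P x] strand_clock[of
      "length P" s]
  show ?case by (cases d) (auto simp: edge_at_def valid_state_def south_edge_def)
next
  case (step m)
  then show ?case by (simp add: strand_def advance_def south_edge_not_in_strip)
qed

lemma strand_in_strip:
  assumes "next_box (strand P F s \<sigma>) \<in> strip P"
  obtains t where "t < length P" "snd (traj_of P F s t) \<in> boxes_of P" "clock_of P F s t = \<sigma>"
      "next_box (strand P F s \<sigma>) = box_at P (snd (traj_of P F s t))"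
proof -
  obtain d x where x: "traj_of P F s (length P) = (d, x, x)" by (rule traj_end)
  have "\<sigma> < clock_of P F s (length P)"
    using strand_final[OF x] assms south_edge_not_in_strip by (metis not_less)
  then obtain t where t: "t < length P" "snd (traj_of P F s t) \<in> boxes_of P" "clock_of P F s t = \<sigma>"
    by (rule clock_less)
  moreover obtain d i j where "traj_of P F s t = (d, i, j)" by (metis prod_cases3)
  ultimately have "next_box (strand P F s \<sigma>) = box_at P (snd (traj_of P F s t))"
    using strand_clock[of t s] by (auto simp: next_box_edge_at)
  with t that show thesis by blast
qed

lemma next_box_strand:
  assumes "t < length P" "snd (traj_of P F s t) \<in> boxes_of P"
  shows "next_box (strand P F s (clock_of P F s t)) = box_at P (snd (traj_of P F s t))"
  using strand_clock[of t s] assms next_box_edge_at[of "fst (snd (traj_of P F s t))"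
      "snd (snd (traj_of P F s t))" P "fst (traj_of P F s t)"] by simp

lemma box_time: "snd (traj_of P F s t) \<in> boxes_of P \<Longrightarrow> t < length P"
  using traj_gap[of "path_step P" "length P" "elbow_set P F" s t "fst (traj_of P F s t)"
      "fst (snd (traj_of P F s t))" "snd (snd (traj_of P F s t))"]
  by (auto simp: path_boxes_def split_beta)

text \<open>Until its clock reaches the final reading a strand faces a box of the strip, which never
  happens at a southern edge; from then on it rests at the edge of its final line.\<close>

lemma strand_exits_at_iff: "strand_exits_at P F s x \<longleftrightarrow> exits (path_step P) (length P) (elbow_set P F) s x"
proof -
  obtain d y where y: "traj_of P F s (length P) = (d, y, y)" by (rule traj_end)
  have "strand_exits_at P F s x \<longleftrightarrow> x = y"
  proof
    assume "strand_exits_at P F s x"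
    then obtain \<sigma> where \<sigma>: "strand P F s \<sigma> = south_edge P x" by (auto simp: strand_exits_at_def)
    have "clock_of P F s (length P) \<le> \<sigma>"
    proof (rule ccontr)
      assume "\<not> clock_of P F s (length P) \<le> \<sigma>"
      then have "\<sigma> < clock_of P F s (length P)" by simp
      then obtain t where t: "t < length P" "snd (traj_of P F s t) \<in> boxes_of P"
          "clock_of P F s t = \<sigma>"
        by (rule clock_less)
      from next_box_strand[OF t(1,2)] t \<sigma> south_edge_not_in_strip[of x] show False
        by (auto simp: strip_eq)
    qed
    with strand_final[OF y] \<sigma> show "x = y" by (simp add: south_edge_inj)
  qed (use strand_final[OF y] in \<open>auto simp: strand_exits_at_def\<close>)
  then show ?thesis using y by (auto simp: exits_iff)
qed

lemma boxes_before_clock: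
  assumes "traj_of P F s t = (d, i, j)" "t \<le> length P"
  shows "boxes_before P F s (clock_of P F s t) = box_at P ` {(a, b) \<in> visits_of P F s. a \<le> i \<and> j \<le> b \<and> (a, b) \<noteq> (i, j)}"
proof (intro equalityI subsetI)
  fix B assume "B \<in> boxes_before P F s (clock_of P F s t)"
  then obtain \<sigma> where \<sigma>: "\<sigma> < clock_of P F s t" "B = next_box (strand P F s \<sigma>)"
      by (auto simp: boxes_before_def)
  then obtain t' where t': "t' < t" "snd (traj_of P F s t') \<in> boxes_of P" "clock_of P F s t' = \<sigma>"
      by (auto elim: clock_less)
  obtain d' a b where ab: "traj_of P F s t' = (d', a, b)" by (metis prod_cases3)
  with t' assms \<sigma> have "B = box_at P (a, b)" using next_box_strand[of t' s] by auto
  moreover have "(a, b) \<in> visits_of P F s" using ab t' by (intro visitsI) auto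
  ultimately show "B \<in> box_at P ` {(a, b) \<in> visits_of P F s. a \<le> i \<and> j \<le> b \<and> (a, b) \<noteq> (i, j)}"
    using traj_before_iff[OF assms(1) ab] t' by auto
next
  fix B assume "B \<in> box_at P ` {(a, b) \<in> visits_of P F s. a \<le> i \<and> j \<le> b \<and> (a, b) \<noteq> (i, j)}"
  then obtain a b where ab: "B = box_at P (a, b)" "(a, b) \<in> visits_of P F s" "a \<le> i" "j \<le> b"
      "(a, b) \<noteq> (i, j)" by auto
  obtain d' t' where t': "traj_of P F s t' = (d', a, b)" using ab(2) by (rule visitsE)
  have "snd (traj_of P F s t') \<in> boxes_of P" using ab t' by (auto simp: visits_def)
  moreover have "t' < t" using traj_before_iff[OF assms(1) t'] ab by simp
  ultimately show "B \<in> boxes_before P F s (clock_of P F s t)"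
    using next_box_strand[of t' s] assms(2) clock_mono_strict[of t' t "path_step P" "length P"
        "elbow_set P F" s] ab t'
    by (auto simp: boxes_before_def strip_eq intro!: exI[of _ "clock_of P F s t'"])
qed

text \<open>The strict order of time and the weak order of pairs differ only in the pair
  \<open>(i, j)\<close>, which is an elbow and so not counted.\<close>

lemma card_common_crossings:
  assumes "traj_of P F s t = (d, i, j)" "traj_of P F s' t' = (d', i, j)" "(i, j) \<in> elbow_set P F"
  shows "card {C \<in> boxes_before P F s (clock_of P F s t) \<inter> boxes_before P F s' (clock_of P F s' t'). F C = Crossing} =
         card {(a, b) \<in> visits_of P F s \<inter> visits_of P F s' - elbow_set P F. a \<le> i \<and> j \<le> b}"
proof -
  have box: "(i, j) \<in> boxes_of P" using assms(3) elbow_set_subset by auto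
  have t: "t \<le> length P" "t' \<le> length P"
    using box_time[of s t] box_time[of s' t'] assms box by auto
  have visits: "visits_of P F s \<subseteq> boxes_of P" for s by (auto simp: visits_def)
  have "{C \<in> boxes_before P F s (clock_of P F s t) \<inter> boxes_before P F s' (clock_of P F s' t'). F C = Crossing} =
     box_at P ` {(a, b) \<in> visits_of P F s \<inter> visits_of P F s' - elbow_set P F. a \<le> i \<and> j \<le> b}" (is "?L = _ ` ?R")
  proof (intro equalityI subsetI)
    fix C assume C: "C \<in> ?L"
    from C obtain a b where ab: "C = box_at P (a, b)" "(a, b) \<in> visits_of P F s" "a \<le> i" "j \<le> b"
      unfolding boxes_before_clock[OF assms(1) t(1)] by auto
    from C obtain a' b' where ab': "C = box_at P (a', b')" "(a', b') \<in> visits_of P F s'"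
      unfolding boxes_before_clock[OF assms(2) t(2)] by auto
    have "(a, b) = (a', b')"
      using ab ab' visits inj_onD[OF inj_on_box_at, of P "(a, b)" "(a', b')" "length P"] by blast
    with ab ab' C have "(a, b) \<in> ?R" by (auto simp: elbow_set_def)
    with ab show "C \<in> box_at P ` ?R" by blast
  next
    fix C assume "C \<in> box_at P ` ?R"
    then obtain a b where *: "C = box_at P (a, b)" "(a, b) \<in> visits_of P F s"
        "(a, b) \<in> visits_of P F s'" "(a, b) \<notin> elbow_set P F" "a \<le> i" "j \<le> b"
      by auto
    with assms(3) have "(a, b) \<noteq> (i, j)" by auto
    moreover have "F C = Crossing" using * visits by (auto simp: elbow_set_def tile_neq_iff)
    ultimately show "C \<in> ?L"
      unfolding boxes_before_clock[OF assms(1) t(1)] boxes_before_clock[OF assms(2) t(2)]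
      using * by blast
  qed
  moreover have "inj_on (box_at P) ?R"
    by (rule inj_on_subset[OF inj_on_box_at[of P "length P"]]) (use visits in auto)
  ultimately show ?thesis by (simp add: card_image)
qed

lemma distinguished_iff: "distinguished P F \<longleftrightarrow> distinguished_set (path_step P) (length P) (elbow_set P F)"
proof
  assume D: "distinguished P F"
  show "distinguished_set (path_step P) (length P) (elbow_set P F)"
    unfolding distinguished_set_def
  proof (intro allI impI)
    fix s s' i j assume *: "s \<noteq> s' \<and> (i, j) \<in> elbow_set P F \<inter> visits_of P F s \<inter> visits_of P F s'"
    obtain d t where t: "traj_of P F s t = (d, i, j)" using * by (auto elim: visitsE)
    obtain d' t' where t': "traj_of P F s' t' = (d', i, j)" using * by (auto elim: visitsE)
    have box: "(i, j) \<in> boxes_of P" using * elbow_set_subset by auto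
    have "next_box (strand P F s (clock_of P F s t)) = box_at P (i, j)"
        "next_box (strand P F s' (clock_of P F s' t')) = box_at P (i, j)"
      using next_box_strand[of t s] next_box_strand[of t' s'] box_time[of s t] box_time[of s' t'] t t' box by auto
    moreover have "box_at P (i, j) \<in> strip P" "F (box_at P (i, j)) = Elbow"
      using * box by (auto simp: strip_eq elbow_set_def)
    ultimately have "even (card {C \<in> boxes_before P F s (clock_of P F s t) \<inter> boxes_before P F s' (clock_of P F s' t'). F C = Crossing})"
      using D * unfolding distinguished_def by blast
    then show "even (card {(a, b) \<in> visits_of P F s \<inter> visits_of P F s' - elbow_set P F. a \<le> i \<and> j \<le> b})"
      using card_common_crossings[OF t t'] * by simp
  qed
next
  assume D: "distinguished_set (path_step P) (length P) (elbow_set P F)"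
  show "distinguished P F"
    unfolding distinguished_def
  proof (intro allI impI, elim conjE)
    fix s s' \<sigma> \<sigma>' B
    assume *: "s \<noteq> s'" "B \<in> strip P" "F B = Elbow" "next_box (strand P F s \<sigma>) = B"
        "next_box (strand P F s' \<sigma>') = B"
    obtain t where t: "snd (traj_of P F s t) \<in> boxes_of P" "clock_of P F s t = \<sigma>"
        "B = box_at P (snd (traj_of P F s t))"
      using strand_in_strip[of s \<sigma>] * by metis
    obtain t' where t': "snd (traj_of P F s' t') \<in> boxes_of P" "clock_of P F s' t' = \<sigma>'"
        "B = box_at P (snd (traj_of P F s' t'))"
      using strand_in_strip[of s' \<sigma>'] * by metis
    \<comment> \<open>Both strands face the same planar box, so they are at the same pair of
      labels.\<close>
    from t t' have eq: "snd (traj_of P F s t) = snd (traj_of P F s' t')"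
      using inj_onD[OF inj_on_box_at] by metis
    obtain d i j where d: "traj_of P F s t = (d, i, j)" by (metis prod_cases3)
    with eq obtain d' where d': "traj_of P F s' t' = (d', i, j)" by (metis prod.collapse snd_conv)
    have elbow: "(i, j) \<in> elbow_set P F" using t d * by (auto simp: elbow_set_def)
    have "(i, j) \<in> visits_of P F s" "(i, j) \<in> visits_of P F s'" using t t' d d'
        by (auto intro: visitsI)
    with D elbow * have "even (card {(a, b) \<in> visits_of P F s \<inter> visits_of P F s' - elbow_set P F. a \<le> i \<and> j \<le> b})"
      unfolding distinguished_set_def by blast
    then show "even (card {C \<in> boxes_before P F s \<sigma> \<inter> boxes_before P F s' \<sigma>'. F C = Crossing})"
      using card_common_crossings[OF d d' elbow] t t' by simp
  qed
qed

end

lemma bij_betw_Deo_max: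
  assumes "P \<noteq> []"
  shows "bij_betw (elbow_set P) (Deo_max f P) (maximal_elbow_sets f (path_step P) (length P))"
proof -
  let ?n = "length P" and ?p = "path_step P"
  have iff: "F \<in> Deo_max f P \<longleftrightarrow> F \<in> periodic_fillings P \<and> elbow_set P F \<in> maximal_elbow_sets f ?p ?n"
      for F
    using assms strand_exits_at_iff[of P F] distinguished_iff[of P F] card_fundamental_elbows[of P F]
      bij_betw_elbow_set[of P]
    by (auto simp: Deo_max_def affine_Deograms_def maximal_elbow_sets_def has_strand_perm_def bij_betw_def)
  then have Deo: "Deo_max f P = {F \<in> periodic_fillings P. elbow_set P F \<in> maximal_elbow_sets f ?p ?n}"
    by blast
  have sub: "maximal_elbow_sets f ?p ?n \<subseteq> elbow_sets ?p ?n" by (auto simp: maximal_elbow_sets_def)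
  show ?thesis
  proof (rule bij_betw_imageI)
    show "inj_on (elbow_set P) (Deo_max f P)"
      by (rule inj_on_subset[OF bij_betw_imp_inj_on[OF bij_betw_elbow_set]]) (simp add: Deo)
    show "elbow_set P ` Deo_max f P = maximal_elbow_sets f ?p ?n"
    proof (intro equalityI subsetI)
      fix E assume E: "E \<in> maximal_elbow_sets f ?p ?n"
      with sub bij_betw_imp_surj_on[OF bij_betw_elbow_set[of P]] obtain F
        where "F \<in> periodic_fillings P" "E = elbow_set P F" by (metis imageE subsetD)
      with E show "E \<in> elbow_set P ` Deo_max f P" by (simp add: Deo)
    qed (auto simp: Deo)
  qed
qed


section \<open>Counting elbows and displacements\<close>

lemma periodic_mult:
  fixes q :: "int \<Rightarrow> 'a"
  assumes "\<And>i. q (i + int n) = q i"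
  shows "q (i + m * int n) = q i"
proof (induction m rule: int_induct[where k = 0])
  case (step1 m)
  with assms[of "i + m * int n"] show ?case by (simp add: algebra_simps)
next
  case (step2 m)
  with assms[of "i + (m - 1) * int n"] show ?case by (simp add: algebra_simps)
qed simp

lemma periodic_residue:
  assumes "\<And>i. q (i + int n) = q i"
  shows "q (residue n i) = q i"
  using periodic_mult[of q n i "- ((i - 1) div int n)"] assms by (simp add: residue_eq)

lemma finite_fundamental_elbows:
  assumes "E \<subseteq> path_boxes p n"
  shows "finite (fundamental_elbows n E)"
proof (rule finite_subset)
  show "fundamental_elbows n E \<subseteq> {1..int n} \<times> {1..2 * int n}"
    using assms by (fastforce simp: fundamental_elbows_def path_boxes_def)
qed simp

text \<open>Identifying the endpoints of one edge lowers the number of classes by at most one.\<close>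

lemma edge_classes:
  assumes "finite V" "finite A"
  shows "\<exists>q :: 'a \<Rightarrow> 'a. (\<forall>(u, v) \<in> A. q u = q v) \<and> card V \<le> card (q ` V) + card A"
  using assms(2)
proof (induction rule: finite_induct)
  case empty
  show ?case by (rule exI[of _ id]) simp
next
  case (insert e A)
  obtain u v where e: "e = (u, v)" by force
  obtain q :: "'a \<Rightarrow> 'a" where q: "\<forall>(u, v) \<in> A. q u = q v" "card V \<le> card (q ` V) + card A"
    using insert.IH by blast
  let ?q = "\<lambda>w. if q w = q u then q v else q w"
  have "card (q ` V) \<le> card (insert (q u) (?q ` V))"
    using assms(1) by (intro card_mono) auto
  also have "\<dots> \<le> Suc (card (?q ` V))" by (rule card_insert_le_m1) auto
  finally have "card V \<le> card (?q ` V) + card (insert e A)"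
    using q(2) insert.hyps by simp
  moreover have "\<forall>(u, v) \<in> insert e A. ?q u = ?q v" using q(1) by (auto simp: e)
  ultimately show ?case by (intro exI[of _ ?q] conjI)
qed

text \<open>Apply \<open>edge_classes\<close> to the graph on the lines \<open>1..n\<close> with one
  edge per fundamental elbow, and compose the labeling with \<open>residue\<close>: this makes it
  periodic and carries its equations over to all elbows.\<close>

lemma elbow_classes:
  assumes "E \<in> elbow_sets p n" "0 < n"
  obtains q :: "int \<Rightarrow> int" where "\<And>i. q (i + int n) = q i" "\<And>i j. (i, j) \<in> E \<Longrightarrow> q i = q j"
    "n \<le> card (q ` {1..int n}) + card (fundamental_elbows n E)"
proof -
  let ?A = "(\<lambda>(i, j). (residue n i, residue n j)) ` fundamental_elbows n E"
  have fin: "finite (fundamental_elbows n E)"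
    using assms(1) by (intro finite_fundamental_elbows[of E p]) (simp add: elbow_sets_def)
  obtain q :: "int \<Rightarrow> int" where q: "\<forall>(u, v) \<in> ?A. q u = q v"
      "card {1..int n} \<le> card (q ` {1..int n}) + card ?A"
    using edge_classes[of "{1..int n}" ?A] fin by blast
  have "q (residue n i) = q (residue n j)" if "(i, j) \<in> E" for i j
  proof -
    define m where "m = - ((i - 1) div int n)"
    have "i + m * int n = residue n i" by (simp add: residue_eq m_def)
    with that elbow_sets_shift[OF assms(1), of i m j] residue_in[OF assms(2), of i]
    have "(i + m * int n, j + m * int n) \<in> fundamental_elbows n E"
        by (simp add: fundamental_elbows_def)
    with q(1) show ?thesis by (fastforce simp: residue_shift)
  qed
  moreover have "(\<lambda>i. q (residue n i)) ` {1..int n} = q ` {1..int n}"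
    by (rule image_cong) (auto simp: residue_id)
  moreover have "card ?A \<le> card (fundamental_elbows n E)" by (rule card_image_le[OF fin])
  ultimately show thesis
    using q(2) residue_shift[of n _ 1] by (intro that[of "\<lambda>i. q (residue n i)"]) auto
qed

lemma reduction_eq: "i \<in> {1..int n} \<Longrightarrow> reduction n f i = residue n (f i)"
  by (simp add: reduction_def residue_def)

context
  fixes n :: nat and p :: "int \<Rightarrow> step" and f :: "int \<Rightarrow> int" and E :: "(int \<times> int) set"
  assumes n: "0 < n" and E: "E \<in> elbow_sets p n" and exits: "\<And>s. exits p n E s (f s)"
begin

text \<open>A periodic labeling that agrees across elbows is constant on cycles, so it factors
  through the set of cycles by a map \<open>h\<close> and has at most as many values as there are
  cycles. If the bound is attained, \<open>h\<close> is injective, and lines with equal values, such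
  as the two lines of an elbow, lie in one cycle.\<close>

lemma
  shows card_elbows_ge: "n \<le> num_cycles n (reduction n f) + card (fundamental_elbows n E)"
    and elbow_same_cycle: "card (fundamental_elbows n E) + num_cycles n (reduction n f) \<le> n \<Longrightarrow>
      (i, j) \<in> E \<Longrightarrow> orbit (reduction n f) (residue n i) = orbit (reduction n f) (residue n j)"
proof -
  let ?g = "reduction n f"
  obtain q :: "int \<Rightarrow> int" where q: "\<And>i. q (i + int n) = q i" "\<And>i j. (i, j) \<in> E \<Longrightarrow> q i = q j"
    "n \<le> card (q ` {1..int n}) + card (fundamental_elbows n E)"
    using elbow_classes[OF E n] by blast
  have g: "q (?g i) = q i" if "i \<in> {1..int n}" for i
    using that exits_class[of q n E p i "f i"] q exits periodic_residue[of q n]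
        by (simp add: reduction_eq)
  \<comment> \<open>Any element of the cycle will do, as \<open>q\<close> is constant on it.\<close>
  define h where "h X = q (SOME z. z \<in> X)" for X
  have h: "q i = h (orbit ?g i)" if i: "i \<in> {1..int n}" for i
  proof -
    have "z \<in> {1..int n} \<and> q z = q i" if "z \<in> orbit ?g i" for z
      using that by induction (use i g residue_in[OF n] in \<open>auto simp: reduction_eq\<close>)
    moreover have "(SOME z. z \<in> orbit ?g i) \<in> orbit ?g i"
      by (rule someI) (rule orbit.base)
    ultimately show ?thesis unfolding h_def by metis
  qed
  have eq: "q ` {1..int n} = h ` orbit ?g ` {1..int n}"
    unfolding image_image by (rule image_cong[OF refl h])
  then have le: "card (q ` {1..int n}) \<le> num_cycles n ?g"
    unfolding num_cycles_def by (metis card_image_le finite_atLeastAtMost_int finite_imageI)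
  with q(3) show "n \<le> num_cycles n ?g + card (fundamental_elbows n E)" by simp
  assume "card (fundamental_elbows n E) + num_cycles n ?g \<le> n" and ij: "(i, j) \<in> E"
  with q(3) have "card (orbit ?g ` {1..int n}) \<le> card (h ` orbit ?g ` {1..int n})"
    unfolding eq num_cycles_def by simp
  then have inj: "inj_on h (orbit ?g ` {1..int n})"
    by (intro eq_card_imp_inj_on antisym card_image_le) auto
  have "h (orbit ?g (residue n i)) = h (orbit ?g (residue n j))"
    using q(2)[OF ij] h[OF residue_in[OF n]] periodic_residue[of q n] q(1) by metis
  with inj residue_in[OF n] show "orbit ?g (residue n i) = orbit ?g (residue n j)"
    by (auto dest: inj_onD)
qed

end

section \<open>Total displacement of the strands\<close>

lemma traj_shift:
  assumes "E \<in> elbow_sets p n" "\<And>i. p (i + int n) = p i" "traj p n E s t = (d, i, j)"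
  shows "traj p n E (s + m * int n) t = (d, i + m * int n, j + m * int n)"
  using assms(3)
proof (induction t arbitrary: d i j)
  case 0
  then show ?case using periodic_mult[of p n s m] assms(2) by auto
next
  case (Suc t)
  obtain d' i' j' where *: "traj p n E s t = (d', i', j')" by (metis prod_cases3)
  from Suc.IH[OF *] Suc.prems * elbow_sets_shift[OF assms(1), of i' m j'] show ?case
    by (auto simp: tick_def algebra_simps split: if_splits)
qed

text \<open>Run the ticks backwards: the direction names the label that moved last, and the earlier
  direction depends on whether the earlier pair is an elbow. The earlier state is valid because
  elbows sit in boxes.\<close>

lemma traj_surj:
  assumes "E \<subseteq> path_boxes p n" "\<And>i. p (i + int n) = p i"
    "valid_state p (d, i, j)" "j - i = int n - int t"
  shows "\<exists>s. traj p n E s t = (d, i, j)"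
  using assms(3,4)
proof (induction t arbitrary: d i j)
  case 0
  then have "j = i + int n" by simp
  with 0 assms(2)[of i] show ?case by (intro exI[of _ i]) (cases d; auto simp: valid_state_def)
next
  case (Suc t)
  show ?case
  proof (cases d)
    case StepR
    have "valid_state p (if (i, j + 1) \<in> E then StepU else StepR, i, j + 1)"
      using Suc.prems assms(1) StepR by (auto simp: valid_state_def path_boxes_def)
    from Suc.IH[OF this] Suc.prems(2) obtain s
      where "traj p n E s t = (if (i, j + 1) \<in> E then StepU else StepR, i, j + 1)" by auto
    with StepR show ?thesis by (intro exI[of _ s]) (auto simp: tick_def)
  next
    case StepU
    have "valid_state p (if (i - 1, j) \<in> E then StepR else StepU, i - 1, j)"
      using Suc.prems assms(1) StepU by (auto simp: valid_state_def path_boxes_def)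
    from Suc.IH[OF this] Suc.prems(2) obtain s
      where "traj p n E s t = (if (i - 1, j) \<in> E then StepR else StepU, i - 1, j)" by auto
    with StepU show ?thesis by (intro exI[of _ s]) (auto simp: tick_def)
  qed
qed

text \<open>All strands have the same gap at time \<open>t\<close>, so one that runs right is
  determined by its row, and by \<open>traj_surj\<close> every row is occupied.\<close>

lemma card_horizontal_strands:
  assumes "E \<in> elbow_sets p n" "\<And>i. p (i + int n) = p i" "0 < n"
  shows "card {s \<in> {1..int n}. fst (traj p n E s t) = StepU} = card {j \<in> {1..int n}. p j = StepU}"
proof -
  have sub: "E \<subseteq> path_boxes p n" using assms(1) by (simp add: elbow_sets_def)
  have state: "traj p n E s t = (StepU, j - (int n - int t), j)"
    if "fst (traj p n E s t) = StepU" "j = snd (snd (traj p n E s t))" for s j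
    using that traj_gap[of p n E s t StepU "fst (snd (traj p n E s t))" j]
        by (cases "traj p n E s t") auto
  have "bij_betw (\<lambda>s. residue n (snd (snd (traj p n E s t))))
     {s \<in> {1..int n}. fst (traj p n E s t) = StepU} {j \<in> {1..int n}. p j = StepU}"
  proof (rule bij_betw_imageI)
    show "inj_on (\<lambda>s. residue n (snd (snd (traj p n E s t)))) {s \<in> {1..int n}. fst (traj p n E s t) = StepU}"
    proof (rule inj_onI, clarify)
      fix s s' assume *: "s \<in> {1..int n}" "s' \<in> {1..int n}"
        "fst (traj p n E s t) = StepU" "fst (traj p n E s' t) = StepU"
        "residue n (snd (snd (traj p n E s t))) = residue n (snd (snd (traj p n E s' t)))"
      define j j' where j: "j = snd (snd (traj p n E s t))" "j' = snd (snd (traj p n E s' t))"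
      \<comment> \<open>The rows differ by \<open>m\<close> periods; at equal times so do the
        states, hence also the labels of the strands.\<close>
      define m where "m = (j' - 1) div int n - (j - 1) div int n"
      from *(5) have "j' = j + m * int n" by (simp add: residue_eq j m_def algebra_simps)
      with state[OF *(3) j(1)] state[OF *(4) j(2)]
      have "traj p n E (s + m * int n) t = traj p n E s' t"
        by (simp add: traj_shift[OF assms(1,2)])
      then have "s' = s + m * int n" by (auto dest: traj_inj)
      with * eq_if_shift_in[of s n m] show "s = s'" by simp
    qed
    show "(\<lambda>s. residue n (snd (snd (traj p n E s t)))) ` {s \<in> {1..int n}. fst (traj p n E s t) = StepU} =
        {j \<in> {1..int n}. p j = StepU}"
    proof (intro equalityI subsetI)
      fix j assume j: "j \<in> {j \<in> {1..int n}. p j = StepU}"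
      then obtain s where s: "traj p n E s t = (StepU, j - (int n - int t), j)"
        using traj_surj[OF sub assms(2), of StepU "j - (int n - int t)" j t]
            by (auto simp: valid_state_def)
      define m where "m = - ((s - 1) div int n)"
      have "s + m * int n = residue n s" by (simp add: residue_eq m_def)
      moreover note traj_shift[OF assms(1,2) s, of m]
      ultimately show "j \<in> (\<lambda>s. residue n (snd (snd (traj p n E s t)))) ` {s \<in> {1..int n}. fst (traj p n E s t) = StepU}"
        using j residue_in[OF assms(3), of s] residue_shift[of n j m] residue_id[of j n]
        by (intro image_eqI[of _ _ "s + m * int n"]) auto
    next
      fix x assume "x \<in> (\<lambda>s. residue n (snd (snd (traj p n E s t)))) ` {s \<in> {1..int n}. fst (traj p n E s t) = StepU}"
      then obtain s where s: "x = residue n (snd (snd (traj p n E s t)))"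
          "fst (traj p n E s t) = StepU" by auto
      then have "p (snd (snd (traj p n E s t))) = StepU"
        using traj_valid[OF sub assms(2), of s t] by (auto simp: valid_state_def split: prod.splits)
      with s residue_in[OF assms(3)] periodic_residue[of p n] assms(2) show
          "x \<in> {j \<in> {1..int n}. p j = StepU}"
        by simp
    qed
  qed
  then show ?thesis by (rule bij_betw_same_card)
qed

text \<open>The label \<open>i\<close> moves exactly at the ticks that leave the strand running
  right. Hence directions are read after the ticks, at times \<open>1..t\<close> and not
  \<open>0..t - 1\<close>.\<close>

lemma traj_displacement:
  "fst (snd (traj p n E s t)) - s = (\<Sum>t' = 1..t. of_bool (fst (traj p n E s t') = StepU))"
proof (induction t)
  case (Suc t)
  then show ?case by (auto simp: tick_def split: prod.splits if_splits)
qed simp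

text \<open>Count moves to the right by ticks instead of strands: each of the \<open>n\<close> ticks
  contributes the number of up steps.\<close>

lemma sum_displacement:
  assumes "E \<in> elbow_sets p n" "\<And>i. p (i + int n) = p i" "0 < n" "\<And>s. exits p n E s (f s)"
  shows "(\<Sum>s = 1..int n. f s - s) = int (n * card {j \<in> {1..int n}. p j = StepU})"
proof -
  have "f s - s = (\<Sum>t = 1..n. of_bool (fst (traj p n E s t) = StepU))" for s
    using assms(4)[of s] traj_displacement[of p n E s n] by (simp add: exits_iff)
  then have "(\<Sum>s = 1..int n. f s - s) = (\<Sum>s = 1..int n. \<Sum>t = 1..n. of_bool (fst (traj p n E s t) = StepU))"
    by simp
  also have "\<dots> = (\<Sum>t = 1..n. \<Sum>s = 1..int n. of_bool (fst (traj p n E s t) = StepU))"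
    by (rule sum.swap)
  also have "\<dots> = (\<Sum>t = 1..n. int (card {s \<in> {1..int n}. fst (traj p n E s t) = StepU}))"
    by (simp add: Int_def)
  also have "\<dots> = (\<Sum>t = 1..n. int (card {j \<in> {1..int n}. p j = StepU}))"
    using card_horizontal_strands[OF assms(1-3)] by simp
  finally show ?thesis by simp
qed

text \<open>Used for the restricted paths: it turns an element of a factor of the product into the
  correct height of that path.\<close>

lemma Deo_max_nonempty_av:
  assumes "P \<noteq> []" "Deo_max f P \<noteq> {}"
  shows "av (length P) f = real (count_list P StepU)"
proof -
  from assms(2) obtain F where "F \<in> Deo_max f P" by blast
  then have "elbow_set P F \<in> maximal_elbow_sets f (path_step P) (length P)"
    using bij_betw_Deo_max[OF assms(1)] by (auto simp: bij_betw_def)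
  then have "(\<Sum>s = 1..int (length P). f s - s) = int (length P * card {j \<in> {1..int (length P)}. path_step P j = StepU})"
    using assms(1) by (intro sum_displacement path_step_periodic) (auto simp: maximal_elbow_sets_def)
  moreover have "{0<..int (length P)} = {1..int (length P)}" by auto
  then have "card {j \<in> {1..int (length P)}. path_step P j = StepU} = count_list P StepU"
    using path_coord_length[of StepU P] by (simp add: path_coord_def)
  ultimately have "(\<Sum>s = 1..int (length P). real_of_int (f s - s)) = real (length P) * real (count_list P StepU)"
    by (metis of_int_of_nat_eq of_int_sum of_nat_mult)
  with assms(1) show ?thesis by (simp add: av_def)
qed


section \<open>Restriction to a periodic subset\<close>

definition pull :: "(int \<Rightarrow> int) \<Rightarrow> (int \<times> int) set \<Rightarrow> (int \<times> int) set" where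
  "pull \<phi> E = {(a, b). (\<phi> a, \<phi> b) \<in> E}"

lemma pull_iff [simp]: "(a, b) \<in> pull \<phi> E \<longleftrightarrow> (\<phi> a, \<phi> b) \<in> E"
  by (simp add: pull_def)

text \<open>The last two conditions fix the offset of the index: 1 goes to the first positive
  element of \<open>S\<close>, so that \<open>{1..m}\<close> corresponds to
  \<open>S \<inter> {1..n}\<close> and the two systems of representatives match.\<close>

locale periodic_subset =
  fixes n m :: nat and \<phi> :: "int \<Rightarrow> int" and S :: "int set"
  assumes strict_mono: "strict_mono \<phi>" and range: "range \<phi> = S"
    and shift: "\<And>a. \<phi> (a + int m) = \<phi> a + int n"
    and pos: "0 < n" "0 < m" and at_0: "\<phi> 0 \<le> 0" and at_1: "0 < \<phi> 1"
begin

lemma le_iff [simp]: "\<phi> a \<le> \<phi> b \<longleftrightarrow> a \<le> b"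
  using strict_mono by (rule strict_mono_less_eq)

lemma less_iff [simp]: "\<phi> a < \<phi> b \<longleftrightarrow> a < b"
  using strict_mono by (rule strict_mono_less)

lemma eq_iff [simp]: "\<phi> a = \<phi> b \<longleftrightarrow> a = b"
  using strict_mono by (rule strict_mono_eq)

lemma inj: "inj \<phi>"
  by (rule injI) simp

lemma in_S [simp]: "\<phi> a \<in> S"
  using range by auto

lemma S_E:
  assumes "i \<in> S" obtains a where "i = \<phi> a"
  using assms range by auto

lemma shifts: "\<phi> (a + k * int m) = \<phi> a + k * int n"
proof (induction k rule: int_induct[where k = 0])
  case (step1 k)
  with shift[of "a + k * int m"] show ?case by (simp add: algebra_simps)
next
  case (step2 k)
  with shift[of "a + (k - 1) * int m"] show ?case by (simp add: algebra_simps)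
qed simp

lemma S_shift: "i + int n \<in> S \<longleftrightarrow> i \<in> S"
proof
  assume "i + int n \<in> S"
  then obtain a where "i + int n = \<phi> a" by (rule S_E)
  with shift[of "a - int m"] show "i \<in> S" by (metis add_right_cancel diff_add_cancel in_S)
qed (metis S_E in_S shift)

lemma in_fundamental_iff: "\<phi> a \<in> {1..int n} \<longleftrightarrow> a \<in> {1..int m}"
proof -
  have "\<phi> (int m) \<le> int n" "int n < \<phi> (1 + int m)"
    using shift[of 0] shift[of 1] at_0 at_1 by simp_all
  then have "a \<le> int m \<longleftrightarrow> \<phi> a \<le> int n"
    using less_iff[of "int m" a] le_iff[of a "int m"] le_iff[of "1 + int m" a] by linarith
  moreover have "1 \<le> a \<longleftrightarrow> 1 \<le> \<phi> a"
    using at_0 at_1 le_iff[of 1 a] le_iff[of a 0] by linarith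
  ultimately show ?thesis by simp
qed

lemma residue_index: "\<phi> (residue m a) = residue n (\<phi> a)"
proof -
  define k where "k = - ((a - 1) div int m)"
  have a: "residue m a = a + k * int m" by (simp add: residue_eq k_def)
  then have "\<phi> a + k * int n \<in> {1..int n}"
    using residue_in[OF pos(2), of a] in_fundamental_iff[of "residue m a"] by (simp add: shifts)
  then show ?thesis using residue_shift[of n "\<phi> a" k] residue_id[of "\<phi> a + k * int n" n] a
    by (simp add: shifts)
qed

lemma box_iff: "(\<phi> a, \<phi> b) \<in> path_boxes p n \<longleftrightarrow> (a, b) \<in> path_boxes (p \<circ> \<phi>) m"
  by (simp add: path_boxes_def flip: shift)

lemma pull_elbow_sets: "E \<in> elbow_sets p n \<Longrightarrow> pull \<phi> E \<in> elbow_sets (p \<circ> \<phi>) m"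
  using box_iff by (auto simp: elbow_sets_def shift)

lemma card_pull:
  assumes "\<And>i j. (i, j) \<in> X \<Longrightarrow> i \<in> S \<and> j \<in> S"
  shows "card (pull \<phi> X) = card X"
proof -
  have "bij_betw (map_prod \<phi> \<phi>) (pull \<phi> X) X"
    by (rule bij_betw_imageI) (use assms in \<open>fastforce simp: inj_on_def elim: S_E\<close>)+
  then show ?thesis by (rule bij_betw_same_card)
qed

section \<open>Strands on the lines of \<open>S\<close>\<close>

context
  fixes p :: "int \<Rightarrow> step" and E :: "(int \<times> int) set"
  assumes p: "\<And>i. p (i + int n) = p i"
    and E: "E \<subseteq> path_boxes p n"
    and sat: "\<And>i j. (i, j) \<in> E \<Longrightarrow> i \<in> S \<longleftrightarrow> j \<in> S"
begin

text \<open>An elbow on a line of \<open>S\<close> has its other line in \<open>S\<close> too, so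
  the strand goes straight through a whole gap of \<open>S\<close>.\<close>

lemma traj_pass_down:
  assumes "traj p n E s t = (StepR, i, j)" "i \<in> S" "j' \<le> j" "\<And>x. j' < x \<Longrightarrow> x \<le> j \<Longrightarrow> x \<notin> S"
  shows "\<exists>t. traj p n E s t = (StepR, i, j')"
  using assms(3,4,1)
proof (induction arbitrary: t rule: int_ge_induct)
  case (step j)
  then have "(i, j + 1) \<notin> E" using sat[of i "j + 1"] assms(2) by auto
  with step.prems have "traj p n E s (Suc t) = (StepR, i, j)" by (simp add: tick_def)
  then show ?case by (rule step.IH[rotated]) (use step.prems in auto)
qed auto

lemma traj_pass_right:
  assumes "traj p n E s t = (StepU, i, j)" "j \<in> S" "i \<le> i'" "\<And>x. i \<le> x \<Longrightarrow> x < i' \<Longrightarrow> x \<notin> S"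
  shows "\<exists>t. traj p n E s t = (StepU, i', j)"
  using assms(3,4)
proof (induction rule: int_ge_induct)
  case base
  with assms(1) show ?case by blast
next
  case (step i')
  then obtain t where t: "traj p n E s t = (StepU, i', j)" by auto
  from step have "(i', j) \<notin> E" using sat[of i' j] assms(2) by auto
  with t have "traj p n E s (Suc t) = (StepU, i' + 1, j)" by (simp add: tick_def)
  then show ?case by blast
qed

text \<open>One tick of the restricted strand is one tick of the original strand followed by passing
  the lines outside \<open>S\<close> up to the next line of \<open>S\<close>.\<close>

lemma traj_of_pull:
  assumes "traj (p \<circ> \<phi>) m (pull \<phi> E) a t = (d, x, y)"
  shows "\<exists>t. traj p n E (\<phi> a) t = (d, \<phi> x, \<phi> y)"
  using assms
proof (induction t arbitrary: d x y)
  case 0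
  then show ?case by (intro exI[of _ 0]) (auto simp: shift)
next
  case (Suc t)
  obtain d' x' y' where *: "traj (p \<circ> \<phi>) m (pull \<phi> E) a t = (d', x', y')" by (metis prod_cases3)
  note tick = Suc.prems[unfolded traj_Suc *]
  from Suc.IH[OF *] obtain t' where t': "traj p n E (\<phi> a) t' = (d', \<phi> x', \<phi> y')" by blast
  show ?case
  proof (cases "(d' = StepR) = ((x', y') \<notin> pull \<phi> E)")
    case True
    with tick have d: "d = StepR" "x = x'" "y = y' - 1" by (auto simp: tick_def)
    from True t' have "traj p n E (\<phi> a) (Suc t') = (StepR, \<phi> x', \<phi> y' - 1)" by (simp add: tick_def)
    moreover have "\<phi> (y' - 1) \<le> \<phi> y' - 1" using less_iff[of "y' - 1" y'] by linarith
    moreover have "z \<notin> S" if "\<phi> (y' - 1) < z" "z \<le> \<phi> y' - 1" for z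
    proof
      assume "z \<in> S"
      then obtain u where "z = \<phi> u" by (rule S_E)
      with that less_iff[of "y' - 1" u] less_iff[of u y'] show False by linarith
    qed
    ultimately show ?thesis unfolding d using traj_pass_down[of "\<phi> a" "Suc t'"] by simp
  next
    case False
    with tick have d: "d = StepU" "x = x' + 1" "y = y'" by (auto simp: tick_def)
    from False t' have "traj p n E (\<phi> a) (Suc t') = (StepU, \<phi> x' + 1, \<phi> y')" by (simp add: tick_def)
    moreover have "\<phi> x' + 1 \<le> \<phi> (x' + 1)" using less_iff[of x' "x' + 1"] by linarith
    moreover have "z \<notin> S" if "\<phi> x' + 1 \<le> z" "z < \<phi> (x' + 1)" for z
    proof
      assume "z \<in> S"
      then obtain u where "z = \<phi> u" by (rule S_E)
      with that less_iff[of x' u] less_iff[of u "x' + 1"] show False by linarith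
    qed
    ultimately show ?thesis unfolding d using traj_pass_right[of "\<phi> a" "Suc t'"] by simp
  qed
qed

text \<open>The converse holds because the positions of a strand form a chain, on which \<open>y - x\<close> is injective.\<close>

lemma traj_pull_iff:
  "(\<exists>t. traj (p \<circ> \<phi>) m (pull \<phi> E) a t = (d, x, y)) \<longleftrightarrow> (\<exists>t. traj p n E (\<phi> a) t = (d, \<phi> x, \<phi> y))"
proof
  assume "\<exists>t. traj p n E (\<phi> a) t = (d, \<phi> x, \<phi> y)"
  then obtain t where t: "traj p n E (\<phi> a) t = (d, \<phi> x, \<phi> y)" by blast
  have "\<phi> y \<le> \<phi> (x + int m)" using traj_gap[OF t] by (simp add: shift)
  then have "y \<le> x + int m" by simp
  \<comment> \<open>The only time at which the restricted strand can have the gap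
    \<open>y - x\<close>.\<close>
  define t' where "t' = nat (int m - (y - x))"
  obtain d' x' y' where t': "traj (p \<circ> \<phi>) m (pull \<phi> E) a t' = (d', x', y')" by (metis prod_cases3)
  with traj_gap[OF this] \<open>y \<le> x + int m\<close> have eq: "y' - x' = y - x" by (simp add: t'_def)
  obtain u where u: "traj p n E (\<phi> a) u = (d', \<phi> x', \<phi> y')" using traj_of_pull[OF t'] by blast
  have "x \<le> x' \<and> y' \<le> y \<or> x' \<le> x \<and> y \<le> y'"
    using traj_mono[OF t u] traj_mono[OF u t] by (cases "t \<le> u") auto
  with eq have xy: "x' = x" "y' = y" by auto
  with traj_gap[OF t] traj_gap[OF u] t u have "d' = d" by simp
  with t' xy show "\<exists>t. traj (p \<circ> \<phi>) m (pull \<phi> E) a t = (d, x, y)" by blast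
qed (use traj_of_pull in blast)

lemma visits_pull: "visits (p \<circ> \<phi>) m (pull \<phi> E) a = pull \<phi> (visits p n E (\<phi> a))"
proof (rule set_eqI)
  fix C :: "int \<times> int"
  obtain x y where [simp]: "C = (x, y)" by force
  show "C \<in> visits (p \<circ> \<phi>) m (pull \<phi> E) a \<longleftrightarrow> C \<in> pull \<phi> (visits p n E (\<phi> a))"
    using traj_pull_iff[of a _ x y] box_iff[of x y p]
    by (simp only: visits_def Int_iff in_range_traj pull_iff \<open>C = (x, y)\<close>)
qed

lemma exits_pull: "exits (p \<circ> \<phi>) m (pull \<phi> E) a x \<longleftrightarrow> exits p n E (\<phi> a) (\<phi> x)"
  unfolding exits_def in_range_traj using traj_pull_iff by blast

text \<open>The two strands stay on lines of \<open>S\<close> and occupy both lines of a common box.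
  So restriction loses none of their crossings.\<close>

lemma common_visits_in_S:
  assumes "s \<in> S" "s' \<in> S" "s \<noteq> s'" "(i, j) \<in> visits p n E s" "(i, j) \<in> visits p n E s'"
  shows "i \<in> S" "j \<in> S"
  using visits_two_class[where q = "\<lambda>i. i \<in> S", OF S_shift sat assms(3-5)] assms(1,2) by auto

lemma card_crossings_pull:
  assumes "a \<noteq> a'"
  shows "card {(u, v) \<in> visits (p \<circ> \<phi>) m (pull \<phi> E) a \<inter> visits (p \<circ> \<phi>) m (pull \<phi> E) a' - pull \<phi> E. u \<le> x \<and> y \<le> v} =
    card {(i, j) \<in> visits p n E (\<phi> a) \<inter> visits p n E (\<phi> a') - E. i \<le> \<phi> x \<and> \<phi> y \<le> j}"
proof -
  have "{(u, v) \<in> visits (p \<circ> \<phi>) m (pull \<phi> E) a \<inter> visits (p \<circ> \<phi>) m (pull \<phi> E) a' - pull \<phi> E. u \<le> x \<and> y \<le> v} =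
    pull \<phi> {(i, j) \<in> visits p n E (\<phi> a) \<inter> visits p n E (\<phi> a') - E. i \<le> \<phi> x \<and> \<phi> y \<le> j}"
    by (auto simp: visits_pull)
  moreover have "i \<in> S \<and> j \<in> S"
    if "(i, j) \<in> {(i, j) \<in> visits p n E (\<phi> a) \<inter> visits p n E (\<phi> a') - E. i \<le> \<phi> x \<and> \<phi> y \<le> j}" for i j
    using common_visits_in_S[of "\<phi> a" "\<phi> a'" i j] assms that by auto
  ultimately show ?thesis by (simp only: card_pull)
qed

lemma distinguished_pull_iff:
  "distinguished_set (p \<circ> \<phi>) m (pull \<phi> E) \<longleftrightarrow>
    (\<forall>s s' i j. s \<noteq> s' \<and> s \<in> S \<and> s' \<in> S \<and> (i, j) \<in> E \<inter> visits p n E s \<inter> visits p n E s' \<longrightarrow>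
        even (card {(a, b) \<in> visits p n E s \<inter> visits p n E s' - E. a \<le> i \<and> j \<le> b}))"
  (is "_ \<longleftrightarrow> ?R")
proof
  assume D: "distinguished_set (p \<circ> \<phi>) m (pull \<phi> E)"
  show ?R
  proof (intro allI impI, elim conjE)
    fix s s' i j
    assume *: "s \<noteq> s'" "s \<in> S" "s' \<in> S" "(i, j) \<in> E \<inter> visits p n E s \<inter> visits p n E s'"
    then have "i \<in> S" "j \<in> S" using common_visits_in_S[of s s' i j] by auto
    with * obtain a a' x y where [simp]: "s = \<phi> a" "s' = \<phi> a'" "i = \<phi> x" "j = \<phi> y" by (meson S_E)
    from * have "a \<noteq> a'" "(x, y) \<in> pull \<phi> E \<inter> visits (p \<circ> \<phi>) m (pull \<phi> E) a \<inter> visits (p \<circ> \<phi>) m (pull \<phi> E) a'"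
      by (auto simp: visits_pull)
    with D have "even (card {(u, v) \<in> visits (p \<circ> \<phi>) m (pull \<phi> E) a \<inter> visits (p \<circ> \<phi>) m (pull \<phi> E) a' - pull \<phi> E. u \<le> x \<and> y \<le> v})"
      unfolding distinguished_set_def by blast
    then show "even (card {(a, b) \<in> visits p n E s \<inter> visits p n E s' - E. a \<le> i \<and> j \<le> b})"
      by (simp only: card_crossings_pull[OF \<open>a \<noteq> a'\<close>] \<open>s = \<phi> a\<close> \<open>s' = \<phi> a'\<close> \<open>i = \<phi> x\<close> \<open>j = \<phi> y\<close>)
  qed
next
  assume R: ?R
  show "distinguished_set (p \<circ> \<phi>) m (pull \<phi> E)"
    unfolding distinguished_set_def
  proof (intro allI impI, elim conjE)
    fix a a' x y
    assume *: "a \<noteq> a'" "(x, y) \<in> pull \<phi> E \<inter> visits (p \<circ> \<phi>) m (pull \<phi> E) a \<inter> visits (p \<circ> \<phi>) m (pull \<phi> E) a'"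
    then have "\<phi> a \<noteq> \<phi> a'" "(\<phi> x, \<phi> y) \<in> E \<inter> visits p n E (\<phi> a) \<inter> visits p n E (\<phi> a')"
      by (auto simp: visits_pull)
    with R in_S have "even (card {(i, j) \<in> visits p n E (\<phi> a) \<inter> visits p n E (\<phi> a') - E. i \<le> \<phi> x \<and> \<phi> y \<le> j})"
      by blast
    then show "even (card {(u, v) \<in> visits (p \<circ> \<phi>) m (pull \<phi> E) a \<inter> visits (p \<circ> \<phi>) m (pull \<phi> E) a' - pull \<phi> E. u \<le> x \<and> y \<le> v})"
      by (simp only: card_crossings_pull[OF *(1)])
  qed
qed

end

lemma inv_index [simp]: "inv \<phi> (\<phi> a) = a"
  by (rule inv_f_f[OF inj])

end


section \<open>Order indexing and cycle decompositions\<close>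

lemma strict_mono_int_step:
  assumes "\<And>i::int. \<phi> i < (\<phi> (i + 1) :: int)"
  shows "strict_mono \<phi>"
proof (rule strict_monoI)
  fix i j :: int
  assume "i < j"
  then show "\<phi> i < \<phi> j"
  proof (induction rule: int_gr_induct)
    case (step j)
    with assms[of j] show ?case by simp
  qed (rule assms)
qed

text \<open>Makes the definite description in \<open>order_index\<close> unique: from a common
  value, neither map can skip the next or the previous element of the common range.\<close>

lemma strict_mono_int_unique:
  fixes \<phi> \<psi> :: "int \<Rightarrow> int"
  assumes "strict_mono \<phi>" "strict_mono \<psi>" "range \<phi> = range \<psi>" "\<phi> 1 = \<psi> 1"
  shows "\<phi> = \<psi>"
proof
  have le: "\<phi> (i + 1) \<le> \<psi> (i + 1)" if "strict_mono \<phi>" "strict_mono \<psi>" "range \<phi> = range \<psi>"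
      "\<phi> i = \<psi> i"
    for \<phi> \<psi> :: "int \<Rightarrow> int" and i
  proof -
    from that(3) obtain k where k: "\<psi> (i + 1) = \<phi> k" by (metis rangeI imageE)
    with that strict_mono_less[of \<phi> i k] strict_mono_less[of \<psi> i "i + 1"] have "i < k" by simp
    with k strict_mono_less_eq[of \<phi> "i + 1" k] that show ?thesis by simp
  qed
  have ge: "\<phi> (i - 1) \<le> \<psi> (i - 1)" if "strict_mono \<phi>" "strict_mono \<psi>" "range \<phi> = range \<psi>"
      "\<phi> i = \<psi> i"
    for \<phi> \<psi> :: "int \<Rightarrow> int" and i
  proof -
    from that(3) obtain k where k: "\<phi> (i - 1) = \<psi> k" by (metis rangeI imageE)
    with that strict_mono_less[of \<phi> "i - 1" i] strict_mono_less[of \<psi> k i] have "k < i" by simp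
    with k strict_mono_less_eq[of \<psi> k "i - 1"] that show ?thesis by simp
  qed
  fix i
  show "\<phi> i = \<psi> i"
  proof (induction i rule: int_induct[where k = 1])
    case (step1 i)
    with le[of \<phi> \<psi> i] le[of \<psi> \<phi> i] assms show ?case by simp
  next
    case (step2 i)
    with ge[of \<phi> \<psi> i] ge[of \<psi> \<phi> i] assms show ?case by simp
  qed (rule assms)
qed

lemma nths_eq_map_filter: "nths P I = map ((!) P) (filter (\<lambda>k. k \<in> I) [0..<length P])"
proof (induction P rule: rev_induct)
  case (snoc a P)
  have "map ((!) (P @ [a])) (filter (\<lambda>k. k \<in> I) [0..<length P]) = map ((!) P) (filter (\<lambda>k. k \<in> I) [0..<length P])"
    by (auto simp: nth_append)
  with snoc show ?case by (simp add: nths_append)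
qed simp

text \<open>One list \<open>xs\<close> of kept positions serves both purposes: continued
  periodically it satisfies the description of \<open>order_index\<close>, and
  \<open>restrict_path\<close> picks the steps at exactly these positions.\<close>

lemma
  fixes n :: nat and S :: "int set"
  defines "m \<equiv> card (S \<inter> {1..int n})"
  assumes S: "\<And>i. i + int n \<in> S \<longleftrightarrow> i \<in> S" and n: "0 < n" and m: "0 < m"
  shows periodic_subset_order_index: "periodic_subset n m (order_index S) S"
    and length_restrict_path: "length P = n \<Longrightarrow> length (restrict_path S P) = m"
    and path_step_restrict_path:
      "length P = n \<Longrightarrow> path_step (restrict_path S P) = path_step P \<circ> order_index S"
proof -
  define xs where "xs = filter (\<lambda>k. int k + 1 \<in> S) [0..<n]"
  have set_xs: "set xs = {k. k < n \<and> int k + 1 \<in> S}" by (auto simp: xs_def)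
  have "bij_betw (\<lambda>k. int k + 1) (set xs) (S \<inter> {1..int n})"
    by (rule bij_betwI[where g = "\<lambda>i. nat (i - 1)"]) (auto simp: set_xs)
  moreover have "distinct xs" by (simp add: xs_def)
  ultimately have len: "length xs = m"
    using bij_betw_same_card distinct_card unfolding m_def by metis
  have sorted: "xs ! k < xs ! l" if "k < l" "l < m" for k l
    using that sorted_wrt_nth_less[of "(<)" xs k l]
        by (simp add: xs_def len[symmetric] sorted_wrt_filter)
  have xs: "xs ! k < n" "int (xs ! k) + 1 \<in> S" if "k < m" for k
    using that set_xs len nth_mem[of k xs] by auto
  \<comment> \<open>Positions in \<open>xs\<close> start at 0 and labels at 1, hence the shifts by
    one; the quotient counts periods.\<close>
  define \<phi> where "\<phi> i = int (xs ! nat ((i - 1) mod int m)) + 1 + (i - 1) div int m * int n" for i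
  have \<phi>: "\<phi> (q * int m + int k + 1) = int (xs ! k) + 1 + q * int n" if "k < m" for q k
    using that m by (simp add: \<phi>_def)
  have ex: "\<exists>q k. k < m \<and> i = q * int m + int k + 1" for i
    by (rule exI[of _ "(i - 1) div int m"], rule exI[of _
        "nat ((i - 1) mod int m)"]) (use m in \<open>auto simp: nat_less_iff\<close>)
  have S': "i + q * int n \<in> S \<longleftrightarrow> i \<in> S" for i q
    by (rule periodic_mult[where q = "\<lambda>i. i \<in> S"]) (rule S)
  have mono: "strict_mono \<phi>"
  proof (rule strict_mono_int_step)
    fix i
    obtain q k where k: "k < m" "i = q * int m + int k + 1" using ex by blast
    show "\<phi> i < \<phi> (i + 1)"
    proof (cases "Suc k < m")
      case True
      with sorted[of k "Suc k"] \<phi>[OF True, of q] \<phi>[OF k(1), of q] k show ?thesis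
          by (simp add: add.commute)
    next
      case False
      \<comment> \<open>\<open>k\<close> is the last index of its period, so the next element is the
        first one of the following period.\<close>
      with k have "i + 1 = (q + 1) * int m + int 0 + 1" by (simp add: algebra_simps)
      then have "\<phi> (i + 1) = int (xs ! 0) + 1 + (q + 1) * int n" using \<phi>[OF m] by metis
      with \<phi>[OF k(1), of q] k xs(1)[OF k(1)] show ?thesis by (simp add: algebra_simps)
    qed
  qed
  have range: "range \<phi> = S"
  proof (intro equalityI subsetI)
    fix i assume "i \<in> range \<phi>"
    then obtain a where "i = \<phi> a" by blast
    moreover obtain q k where "k < m" "a = q * int m + int k + 1" using ex by blast
    ultimately show "i \<in> S" using \<phi>[of k q] xs(2)[of k] S' by simp
  next
    fix i assume i: "i \<in> S"
    define q where "q = (i - 1) div int n"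
    define l where "l = nat ((i - 1) mod int n)"
    have l: "i = int l + 1 + q * int n" using n by (simp add: q_def l_def)
    moreover have "l < n" using n by (simp add: l_def nat_less_iff)
    ultimately have "l \<in> set xs" using i S' by (simp add: set_xs)
    then obtain k where "k < m" "xs ! k = l" using len by (auto simp: in_set_conv_nth)
    with \<phi>[of k q] l show "i \<in> range \<phi>" by (metis rangeI)
  qed
  have at_1: "\<phi> 1 = int (xs ! 0) + 1" using \<phi>[OF m, of 0] by simp
  have at_0: "\<phi> 0 = int (xs ! (m - 1)) + 1 - int n" using \<phi>[of "m - 1" "- 1"] m
      by (simp add: of_nat_diff)
  have sub: "\<phi> 0 \<le> 0" using at_0 xs(1)[of "m - 1"] m by simp
  have Least: "\<phi> 1 = (LEAST i. i \<in> S \<and> 1 \<le> i)"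
  proof (rule Least_equality[symmetric])
    show "\<phi> 1 \<in> S \<and> 1 \<le> \<phi> 1" using xs(2)[OF m] at_1 by simp
    fix i assume i: "i \<in> S \<and> 1 \<le> i"
    with range obtain a where a: "i = \<phi> a" by auto
    with i sub have "\<phi> 0 < \<phi> a" by simp
    then show "\<phi> 1 \<le> i" using mono a strict_mono_less[OF mono, of 0 a] strict_mono_less_eq[OF mono, of 1 a] by simp
  qed
  have index: "order_index S = \<phi>"
    unfolding order_index_def
    by (rule the_equality) (use mono range Least strict_mono_int_unique in auto)
  have "\<phi> (a + int m) = \<phi> a + int n" for a
  proof -
    have "a + int m - 1 = a - 1 + int m" by simp
    with m show ?thesis unfolding \<phi>_def by (simp only: mod_add_self2) (simp add: distrib_right)
  qed
  with mono range n m sub at_1 show periodic: "periodic_subset n m (order_index S) S"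
    unfolding index by unfold_locales auto
  assume P: "length P = n"
  have restrict: "restrict_path S P = map ((!) P) xs"
    by (simp add: restrict_path_def nths_eq_map_filter xs_def P)
  then show len': "length (restrict_path S P) = m" by (simp add: len)
  show "path_step (restrict_path S P) = path_step P \<circ> order_index S"
  proof
    fix a
    obtain q k where k: "k < m" "a = q * int m + int k + 1" using ex by blast
    have "path_step (restrict_path S P) a = P ! (xs ! k)"
      using k m len by (simp add: path_step_def len' restrict)
    also have "\<dots> = path_step P (\<phi> a)"
      using k xs(1)[OF k(1)] by (simp add: \<phi> path_step_def P)
    finally show "path_step (restrict_path S P) a = (path_step P \<circ> order_index S) a"
      by (simp add: index)
  qed
qed

text \<open>By disjointness the other cycles fix both \<open>a\<close> and its image under
  \<open>c\<close>.\<close>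

lemma foldr_cycles_apply:
  assumes "distinct (concat cs)" "c \<in> set cs" "a \<in> set c"
  shows "foldr (\<circ>) (map cycle_of_list cs) id a = cycle_of_list c a"
proof -
  have outside: "foldr (\<circ>) (map cycle_of_list cs) id a = a" if "a \<notin> set (concat cs)"
      for cs and a :: 'a
    using that by (induction cs) (auto simp: id_outside_supp)
  show ?thesis
    using assms
  proof (induction cs)
    case (Cons d cs)
    have comp: "foldr (\<circ>) (map cycle_of_list (d # cs)) id a =
        cycle_of_list d (foldr (\<circ>) (map cycle_of_list cs) id a)"
      by (simp only: list.map foldr_Cons comp_apply)
    show ?case
    proof (cases "c = d")
      case True
      with Cons.prems have "a \<notin> set (concat cs)" by auto
      from True outside[OF this] show ?thesis by (simp only: comp)
    next
      case False
      then have "foldr (\<circ>) (map cycle_of_list cs) id a = cycle_of_list c a"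
        using Cons.prems by (intro Cons.IH) auto
      moreover have "cycle_of_list c a \<in> set c"
        using cycle_permutes[of c] Cons.prems(3) by (simp add: permutes_in_image)
      then have "cycle_of_list c a \<notin> set d" using Cons.prems(1,2) False by auto
      ultimately show ?thesis unfolding comp by (simp only: id_outside_supp not_False_eq_True)
    qed
  qed simp
qed

lemma orbit_cycle_of_list:
  assumes "distinct c" "a \<in> set c"
  shows "orbit (cycle_of_list c) a = set c"
proof (intro equalityI subsetI)
  fix b assume "b \<in> orbit (cycle_of_list c) a"
  then show "b \<in> set c"
    by induction (use assms cycle_permutes[of c] in \<open>auto simp: permutes_in_image\<close>)
next
  fix b assume "b \<in> set c"
  then obtain l where l: "l < length c" "b = c ! l" by (auto simp: in_set_conv_nth)
  from assms(2) obtain k where k: "k < length c" "a = c ! k" by (auto simp: in_set_conv_nth)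
  \<comment> \<open>Rotating by \<open>l - k\<close> moves position \<open>k\<close> to
    \<open>l\<close>; adding \<open>length c\<close> keeps the exponent positive, as orbits
    require.\<close>
  define t where "t = l + length c - k"
  have "(cycle_of_list c ^^ t) a = rotate t c ! k"
    using cyclic_rotation[OF assms(1), of t] k by (metis nth_map)
  also have "\<dots> = b" using k l by (simp add: nth_rotate t_def)
  finally show "b \<in> orbit (cycle_of_list c) a"
    using k by (auto simp: orbit_altdef t_def intro!: exI[of _ t])
qed

lemma orbit_cycle_decomposition:
  assumes "is_cycle_decomposition n g cs" "c \<in> set cs" "a \<in> set c"
  shows "orbit g a = set c"
proof -
  have c: "distinct c" using assms by (auto simp: is_cycle_decomposition_def distinct_concat_iff)
  have "orbit g a = orbit (cycle_of_list c) a"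
  proof (rule orbit_cong0[OF assms(3)])
    show eq: "g y = cycle_of_list c y" if "y \<in> set c" for y
      using assms(1) foldr_cycles_apply[OF _ assms(2) that]
          by (simp add: is_cycle_decomposition_def)
    show "g \<in> set c \<rightarrow> set c"
      using eq cycle_permutes[of c] by (auto simp: permutes_in_image)
  qed
  with orbit_cycle_of_list[OF c assms(3)] show ?thesis by simp
qed

lemma num_cycles_cycle_decomposition:
  assumes "is_cycle_decomposition n g cs"
  shows "num_cycles n g = length cs"
proof -
  have cs: "\<forall>c \<in> set cs. c \<noteq> []" "distinct (concat cs)" "set (concat cs) = {1..int n}"
    using assms by (simp_all add: is_cycle_decomposition_def)
  have "orbit g ` {1..int n} = set ` set cs"
  proof (intro equalityI subsetI)
    fix X assume "X \<in> orbit g ` {1..int n}"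
    with cs(3) orbit_cycle_decomposition[OF assms] show "X \<in> set ` set cs" by fastforce
  next
    fix X assume "X \<in> set ` set cs"
    then obtain c where c: "c \<in> set cs" "X = set c" by blast
    with cs(1) obtain a where a: "a \<in> set c" by (metis last_in_set)
    have "a \<in> {1..int n}" using a c cs(3) by auto
    with orbit_cycle_decomposition[OF assms c(1) a] c(2) show "X \<in> orbit g ` {1..int n}" by blast
  qed
  moreover have "inj_on set (set cs)"
  proof (rule inj_onI, rule ccontr)
    fix c d assume "c \<in> set cs" "d \<in> set cs" "set c = set d" "c \<noteq> d"
    with cs(2) have "set c \<inter> set d = {}" unfolding distinct_concat_iff by blast
    moreover have "d \<noteq> []" using cs(1) \<open>d \<in> set cs\<close> by blast
    ultimately show False using \<open>set c = set d\<close> by simp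
  qed
  moreover have "distinct cs" using cs by (auto simp: distinct_concat_iff)
  ultimately show ?thesis by (simp add: num_cycles_def card_image distinct_card)
qed

text \<open>The residues of \<open>g i\<close> permute \<open>{1..m}\<close>, so in the sum of
  \<open>g i - i\<close> only the quotients by \<open>m\<close> survive, each multiplied by
  \<open>m\<close>. This is what makes \<open>k_j\<close> a natural number.\<close>

lemma av_natural:
  assumes "affine_perm m g" "\<And>i. i \<le> g i" "0 < m"
  shows "\<exists>k::nat. av m g = real k"
proof -
  have g: "inj g" "\<And>i. g (i + int m) = g i + int m"
    using assms(1) by (auto simp: affine_perm_def bij_def)
  have gk: "g (i + k * int m) = g i + k * int m" for i k
    using periodic_mult[of "\<lambda>i. g i - i" m i k] g(2) by simp
  have "inj_on (\<lambda>i. residue m (g i)) {1..int m}"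
  proof (rule inj_onI)
    fix i j assume *: "i \<in> {1..int m}" "j \<in> {1..int m}" "residue m (g i) = residue m (g j)"
    define k where "k = (g j - 1) div int m - (g i - 1) div int m"
    have "g j = g i + k * int m" using *(3) by (simp add: residue_eq k_def algebra_simps)
    then have "g j = g (i + k * int m)" by (simp only: gk)
    with g(1) have "j = i + k * int m" by (auto dest: injD)
    with * eq_if_shift_in[of i m k] show "i = j" by simp
  qed
  then have "bij_betw (\<lambda>i. residue m (g i)) {1..int m} {1..int m}"
    using endo_inj_surj[of "{1..int m}" "\<lambda>i. residue m (g i)"] residue_in[OF assms(3)]
    unfolding bij_betw_def by blast
  then have "(\<Sum>i = 1..int m. residue m (g i)) = (\<Sum>i = 1..int m. i)"
    by (rule sum.reindex_bij_betw)
  then have "(\<Sum>i = 1..int m. g i - i) = (\<Sum>i = 1..int m. (g i - 1) div int m) * int m"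
    by (simp add: residue_eq sum_subtractf sum_distrib_right)
  moreover define s where "s = (\<Sum>i = 1..int m. (g i - 1) div int m)"
  ultimately have s: "(\<Sum>i = 1..int m. g i - i) = s * int m" by simp
  moreover have "0 \<le> (\<Sum>i = 1..int m. g i - i)" by (rule sum_nonneg) (simp add: assms(2))
  ultimately have "0 \<le> s" using assms(3) by (simp add: zero_le_mult_iff)
  have "(\<Sum>i = 1..int m. real_of_int (g i - i)) = real_of_int s * real m"
    using s by (metis of_int_mult of_int_of_nat_eq of_int_sum)
  with assms(3) \<open>0 \<le> s\<close> show ?thesis
    by (intro exI[of _ "nat s"]) (simp add: av_def)
qed


section \<open>Decomposition into classes\<close>

locale cycle_classes =
  fixes n r :: nat and m :: "nat \<Rightarrow> nat" and \<phi> :: "nat \<Rightarrow> int \<Rightarrow> int" and S :: "nat \<Rightarrow> int set"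
  assumes subset: "c < r \<Longrightarrow> periodic_subset n (m c) (\<phi> c) (S c)"
    and partition: "\<exists>!c. c < r \<and> i \<in> S c"
begin

definition intra :: "(int \<times> int) set \<Rightarrow> bool" where
  "intra E \<longleftrightarrow> (\<forall>(i, j) \<in> E. \<exists>c<r. i \<in> S c \<and> j \<in> S c)"

text \<open>Boxes whose two lines belong to different classes receive no elbow, so they become
  crossings.\<close>

definition glue :: "(nat \<Rightarrow> (int \<times> int) set) \<Rightarrow> (int \<times> int) set" where
  "glue X = (\<Union>c<r. map_prod (\<phi> c) (\<phi> c) ` X c)"

lemma class_unique: "c < r \<Longrightarrow> c' < r \<Longrightarrow> i \<in> S c \<Longrightarrow> i \<in> S c' \<Longrightarrow> c = c'"
  using partition[of i] by blast

lemma n_pos: "0 < n"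
  using partition[of 0] subset periodic_subset.pos(1) by blast

lemma m_pos: "c < r \<Longrightarrow> 0 < m c"
  using subset periodic_subset.pos(2) by blast

lemma intra_saturated:
  assumes "intra E" "c < r" "(i, j) \<in> E"
  shows "i \<in> S c \<longleftrightarrow> j \<in> S c"
proof -
  from assms obtain c' where "c' < r" "i \<in> S c'" "j \<in> S c'" unfolding intra_def by blast
  then show ?thesis using class_unique[OF assms(2), of c'] by blast
qed

lemma sum_m: "(\<Sum>c<r. m c) = n"
proof -
  have "card (S c \<inter> {1..int n}) = m c" if "c < r" for c
  proof -
    interpret periodic_subset n "m c" "\<phi> c" "S c" by (rule subset[OF that])
    have "S c \<inter> {1..int n} = \<phi> c ` {1..int (m c)}"
      using in_fundamental_iff by (auto elim!: S_E)
    then show ?thesis using card_image[OF inj_on_subset[OF inj]] by simp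
  qed
  then have "(\<Sum>c<r. m c) = (\<Sum>c<r. card (S c \<inter> {1..int n}))" by simp
  also have "\<dots> = card (\<Union>c<r. S c \<inter> {1..int n})"
    by (rule card_UN_disjoint[symmetric]) (auto dest: class_unique)
  also have "(\<Union>c<r. S c \<inter> {1..int n}) = {1..int n}" using partition by blast
  finally show ?thesis by simp
qed

text \<open>The fundamental domains match under \<open>\<phi> c\<close> by
  \<open>in_fundamental_iff\<close>, and \<open>intra\<close> leaves no elbow outside the
  classes.\<close>

lemma card_fundamental_pull:
  assumes "E \<subseteq> path_boxes p n" "intra E"
  shows "card (fundamental_elbows n E) = (\<Sum>c<r. card (fundamental_elbows (m c) (pull (\<phi> c) E)))"
proof -
  define X where "X c = {(i, j) \<in> fundamental_elbows n E. i \<in> S c \<and> j \<in> S c}" for c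
  have "card (fundamental_elbows (m c) (pull (\<phi> c) E)) = card (X c)" if "c < r" for c
  proof -
    interpret periodic_subset n "m c" "\<phi> c" "S c" by (rule subset[OF that])
    have "fundamental_elbows (m c) (pull (\<phi> c) E) = pull (\<phi> c) (X c)"
    proof (rule set_eqI)
      fix C :: "int \<times> int"
      obtain a b where C: "C = (a, b)" by force
      show "C \<in> fundamental_elbows (m c) (pull (\<phi> c) E) \<longleftrightarrow> C \<in> pull (\<phi> c) (X c)"
        using in_fundamental_iff[of a] by (auto simp: C X_def fundamental_elbows_def)
    qed
    moreover have "card (pull (\<phi> c) (X c)) = card (X c)" by (rule card_pull) (auto simp: X_def)
    ultimately show ?thesis by simp
  qed
  then have "(\<Sum>c<r. card (fundamental_elbows (m c) (pull (\<phi> c) E))) = (\<Sum>c<r. card (X c))" by simp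
  also have "\<dots> = card (\<Union>c<r. X c)"
  proof (rule card_UN_disjoint[symmetric])
    show "\<forall>c\<in>{..<r}. finite (X c)"
      using finite_fundamental_elbows[OF assms(1)] by (auto simp: X_def intro: finite_subset)
    show "\<forall>c\<in>{..<r}. \<forall>c'\<in>{..<r}. c \<noteq> c' \<longrightarrow> X c \<inter> X c' = {}"
      by (auto simp: X_def dest: class_unique)
  qed simp
  also have "(\<Union>c<r. X c) = fundamental_elbows n E"
    using assms(2) by (fastforce simp: X_def fundamental_elbows_def intra_def)
  finally show ?thesis by simp
qed

lemma glue_elbow_sets:
  assumes "\<And>c. c < r \<Longrightarrow> X c \<in> elbow_sets (p \<circ> \<phi> c) (m c)"
  shows "glue X \<in> elbow_sets p n"
proof -
  have "glue X \<subseteq> path_boxes p n"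
  proof
    fix C assume "C \<in> glue X"
    then obtain c a b where c: "c < r" "(a, b) \<in> X c" "C = (\<phi> c a, \<phi> c b)" by (auto simp: glue_def)
    with assms[OF c(1)] periodic_subset.box_iff[OF subset[OF c(1)], of a b p]
    show "C \<in> path_boxes p n" by (auto simp: elbow_sets_def)
  qed
  moreover have "(i + k * int n, j + k * int n) \<in> glue X" if "(i, j) \<in> glue X" for i j k
  proof -
    from that obtain c a b where c: "c < r" "(a, b) \<in> X c" "i = \<phi> c a" "j = \<phi> c b"
        by (auto simp: glue_def)
    have "(a + k * int (m c), b + k * int (m c)) \<in> X c"
      using elbow_sets_shift[OF assms[OF c(1)]] c(2) by blast
    then have "map_prod (\<phi> c) (\<phi> c) (a + k * int (m c), b + k * int (m c)) \<in> glue X"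
      using c(1) unfolding glue_def by blast
    then show ?thesis using c periodic_subset.shifts[OF subset[OF c(1)]] by simp
  qed
  from this[of _ _ 1] this[of _ _ "-1"] have "(i + int n, j + int n) \<in> glue X \<longleftrightarrow> (i, j) \<in> glue X"
      for i j
    by fastforce
  ultimately show ?thesis by (simp add: elbow_sets_def)
qed

lemma intra_glue: "intra (glue X)"
  unfolding intra_def glue_def using periodic_subset.in_S[OF subset] by fastforce

lemma pull_glue:
  assumes "c < r"
  shows "pull (\<phi> c) (glue X) = X c"
proof -
  interpret periodic_subset n "m c" "\<phi> c" "S c" by (rule subset[OF assms])
  have "(a, b) \<in> X c" if ab: "(\<phi> c a, \<phi> c b) \<in> glue X" for a b
  proof -
    from ab obtain c' a' b' where c': "c' < r" "(a', b') \<in> X c'" "\<phi> c a = \<phi> c' a'" "\<phi> c b = \<phi> c' b'"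
      by (auto simp: glue_def)
    have "c' = c"
      using class_unique[OF c'(1) assms] periodic_subset.in_S[OF subset[OF c'(1)]] in_S c'(3)
          by metis
    with c' show ?thesis by simp
  qed
  then show ?thesis using assms by (force simp: glue_def)
qed

lemma glue_pull:
  assumes "intra E"
  shows "glue (\<lambda>c\<in>{..<r}. pull (\<phi> c) E) = E"
proof (intro equalityI subsetI)
  fix C assume "C \<in> glue (\<lambda>c\<in>{..<r}. pull (\<phi> c) E)"
  then obtain c a b where "c < r" "(a, b) \<in> pull (\<phi> c) E" "C = (\<phi> c a, \<phi> c b)"
      by (auto simp: glue_def)
  then show "C \<in> E" using pull_iff by simp
next
  fix C assume C: "C \<in> E"
  with assms obtain i j c where c: "C = (i, j)" "c < r" "i \<in> S c" "j \<in> S c" unfolding intra_def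
      by fastforce
  interpret periodic_subset n "m c" "\<phi> c" "S c" by (rule subset[OF c(2)])
  from c obtain a b where ab: "i = \<phi> c a" "j = \<phi> c b" by (meson S_E)
  with C c have "(a, b) \<in> pull (\<phi> c) E" by simp
  with c ab show "C \<in> glue (\<lambda>c\<in>{..<r}. pull (\<phi> c) E)" by (force simp: glue_def)
qed

section \<open>Restriction and gluing of maximal elbow sets\<close>

context
  fixes p :: "int \<Rightarrow> step"
  assumes p: "\<And>i. p (i + int n) = p i"
begin

text \<open>An elbow shared by two strands puts both labels into the class of its box, so pairs of
  strands from different classes impose no condition.\<close>

lemma distinguished_iff_pull:
  assumes "E \<subseteq> path_boxes p n" "intra E"
  shows "distinguished_set p n E \<longleftrightarrow> (\<forall>c<r. distinguished_set (p \<circ> \<phi> c) (m c) (pull (\<phi> c) E))"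
    (is "?L \<longleftrightarrow> ?R")
proof
  assume ?L
  show ?R
  proof (intro allI impI)
    fix c assume c: "c < r"
    interpret periodic_subset n "m c" "\<phi> c" "S c" by (rule subset[OF c])
    show "distinguished_set (p \<circ> \<phi> c) (m c) (pull (\<phi> c) E)"
      using distinguished_pull_iff[OF p assms(1) intra_saturated[OF assms(2) c]] \<open>?L\<close>
      unfolding distinguished_set_def by blast
  qed
next
  assume R: ?R
  show ?L
    unfolding distinguished_set_def
  proof (intro allI impI, elim conjE)
    fix s s' i j
    assume *: "s \<noteq> s'" "(i, j) \<in> E \<inter> visits p n E s \<inter> visits p n E s'"
    from assms(2) * obtain c where c: "c < r" "i \<in> S c" "j \<in> S c" unfolding intra_def by blast
    interpret periodic_subset n "m c" "\<phi> c" "S c" by (rule subset[OF c(1)])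
    note sat = intra_saturated[OF assms(2) c(1)]
    have "(i, j) \<in> visits p n E s" "(i, j) \<in> visits p n E s'" using * by auto
    from visits_two_class[where q = "\<lambda>i. i \<in> S c", OF S_shift sat *(1) this]
    have "s \<in> S c" "s' \<in> S c" using c by auto
    with R c(1) * show "even (card {(a, b) \<in> visits p n E s \<inter> visits p n E s' - E. a \<le> i \<and> j \<le> b})"
      using distinguished_pull_iff[OF p assms(1) sat] by blast
  qed
qed

lemma exits_iff_pull:
  assumes "E \<subseteq> path_boxes p n" "intra E" "\<And>c a. c < r \<Longrightarrow> \<phi> c (g c a) = f (\<phi> c a)"
  shows "(\<forall>s. exits p n E s (f s)) \<longleftrightarrow> (\<forall>c<r. \<forall>a. exits (p \<circ> \<phi> c) (m c) (pull (\<phi> c) E) a (g c a))"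
proof -
  have pull: "exits (p \<circ> \<phi> c) (m c) (pull (\<phi> c) E) a (g c a) \<longleftrightarrow> exits p n E (\<phi> c a) (f (\<phi> c a))"
    if c: "c < r" for c a
  proof -
    interpret periodic_subset n "m c" "\<phi> c" "S c" by (rule subset[OF c])
    show ?thesis
      using exits_pull[OF p assms(1) intra_saturated[OF assms(2) c]] assms(3)[OF c] by simp
  qed
  have "\<exists>c a. c < r \<and> s = \<phi> c a" for s
    using partition[of s] subset periodic_subset.S_E by meson
  with pull show ?thesis by metis
qed

context
  fixes f :: "int \<Rightarrow> int" and g :: "nat \<Rightarrow> int \<Rightarrow> int"
  assumes g: "\<And>c a. c < r \<Longrightarrow> \<phi> c (g c a) = f (\<phi> c a)"
    and num_f: "num_cycles n (reduction n f) = r"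
    and num_g: "\<And>c. c < r \<Longrightarrow> num_cycles (m c) (reduction (m c) (g c)) = 1"
    and orbit_f: "\<And>i j. orbit (reduction n f) (residue n i) = orbit (reduction n f) (residue n j) \<Longrightarrow>
      \<exists>c<r. i \<in> S c \<and> j \<in> S c"
begin

lemma maximal_intra:
  assumes "E \<in> maximal_elbow_sets f p n"
  shows "intra E"
proof -
  \<comment> \<open>Subtraction on \<open>nat\<close> truncates, so the number \<open>n - r\<close>
    of elbows only yields the required inequality together with \<open>r \<le> n\<close>.\<close>
  have "r \<le> n" using sum_m sum_mono[of "{..<r}" "\<lambda>_. 1" m] m_pos by (simp add: Suc_le_eq)
  with assms elbow_same_cycle[OF n_pos, of E p f] orbit_f num_f show ?thesis
    unfolding intra_def maximal_elbow_sets_def by auto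
qed

lemma maximal_iff_pull:
  assumes "E \<in> elbow_sets p n" "intra E"
  shows "E \<in> maximal_elbow_sets f p n \<longleftrightarrow>
    (\<forall>c<r. pull (\<phi> c) E \<in> maximal_elbow_sets (g c) (p \<circ> \<phi> c) (m c))"
proof -
  have sub: "E \<subseteq> path_boxes p n" using assms(1) by (simp add: elbow_sets_def)
  have pull: "pull (\<phi> c) E \<in> elbow_sets (p \<circ> \<phi> c) (m c)" if "c < r" for c
    by (rule periodic_subset.pull_elbow_sets[OF subset[OF that] assms(1)])
  have sum: "(\<Sum>c<r. m c - 1) = n - r"
    using sum_subtractf_nat[of "{..<r}" "\<lambda>_. 1" m] m_pos sum_m by (simp add: Suc_le_eq)
  \<comment> \<open>The lower bounds inside the classes rest on the exits, so the counts are
    compared under the condition \<open>ex\<close>.\<close>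
  have "card (fundamental_elbows n E) = n - r \<longleftrightarrow>
      (\<forall>c<r. card (fundamental_elbows (m c) (pull (\<phi> c) E)) = m c - 1)" (is "?L \<longleftrightarrow> ?R")
    if ex: "\<And>c a. c < r \<Longrightarrow> exits (p \<circ> \<phi> c) (m c) (pull (\<phi> c) E) a (g c a)"
  proof
    assume ?L
    then have eq: "(\<Sum>c<r. m c - 1) = (\<Sum>c<r. card (fundamental_elbows (m c) (pull (\<phi> c) E)))"
      using sum card_fundamental_pull[OF sub assms(2)] by simp
    \<comment> \<open>Each class is a single cycle of \<open>g c\<close>. With these bounds,
      equality of the sums forces equality of the terms.\<close>
    have "m c - 1 \<le> card (fundamental_elbows (m c) (pull (\<phi> c) E))" if "c < r" for c
      using card_elbows_ge[OF m_pos pull, of c "g c"] ex num_g that by simp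
    with sum_mono_inv[OF eq] show ?R by auto
  next
    assume ?R
    then show ?L using sum card_fundamental_pull[OF sub assms(2)] by simp
  qed
  then show ?thesis
    using assms(1) pull exits_iff_pull[OF sub assms(2) g] distinguished_iff_pull[OF sub assms(2)] num_f num_g
    unfolding maximal_elbow_sets_def mem_Collect_eq by (metis (no_types, lifting))
qed

lemma bij_betw_maximal:
  "bij_betw (\<lambda>E. \<lambda>c\<in>{..<r}. pull (\<phi> c) E) (maximal_elbow_sets f p n)
    (\<Pi>\<^sub>E c\<in>{..<r}. maximal_elbow_sets (g c) (p \<circ> \<phi> c) (m c))"
proof (rule bij_betwI[where g = glue])
  have "E \<in> elbow_sets p n" if "E \<in> maximal_elbow_sets f p n" for E
    using that by (simp add: maximal_elbow_sets_def)
  then show "(\<lambda>E. \<lambda>c\<in>{..<r}. pull (\<phi> c) E) \<in> maximal_elbow_sets f p n \<rightarrow>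
      (\<Pi>\<^sub>E c\<in>{..<r}. maximal_elbow_sets (g c) (p \<circ> \<phi> c) (m c))"
    using maximal_iff_pull maximal_intra by (intro funcsetI PiE_I) auto
  show "glue \<in> (\<Pi>\<^sub>E c\<in>{..<r}. maximal_elbow_sets (g c) (p \<circ> \<phi> c) (m c)) \<rightarrow> maximal_elbow_sets f p n"
  proof
    fix X assume X: "X \<in> (\<Pi>\<^sub>E c\<in>{..<r}. maximal_elbow_sets (g c) (p \<circ> \<phi> c) (m c))"
    then have X': "X c \<in> maximal_elbow_sets (g c) (p \<circ> \<phi> c) (m c)" if "c < r" for c
      using that by auto
    then have "glue X \<in> elbow_sets p n"
      by (intro glue_elbow_sets) (auto simp: maximal_elbow_sets_def)
    with X' show "glue X \<in> maximal_elbow_sets f p n"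
      using maximal_iff_pull[OF _ intra_glue] pull_glue by simp
  qed
  show "glue (\<lambda>c\<in>{..<r}. pull (\<phi> c) E) = E" if "E \<in> maximal_elbow_sets f p n" for E
    by (rule glue_pull[OF maximal_intra[OF that]])
  show "(\<lambda>c\<in>{..<r}. pull (\<phi> c) (glue X)) = X"
    if "X \<in> (\<Pi>\<^sub>E c\<in>{..<r}. maximal_elbow_sets (g c) (p \<circ> \<phi> c) (m c))" for X
    by (rule extensionalityI[OF restrict_extensional]) (use that pull_glue in \<open>auto simp: PiE_iff\<close>)
qed

end

end

end

lemma bij_betw_PiE:
  assumes "\<And>i. i \<in> I \<Longrightarrow> bij_betw (h i) (A i) (B i)"
  shows "bij_betw (\<lambda>x. \<lambda>i\<in>I. h i (x i)) (Pi\<^sub>E I A) (Pi\<^sub>E I B)"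
proof (rule bij_betwI[where g = "\<lambda>y. \<lambda>i\<in>I. inv_into (A i) (h i) (y i)"])
  show "(\<lambda>x. \<lambda>i\<in>I. h i (x i)) \<in> Pi\<^sub>E I A \<rightarrow> Pi\<^sub>E I B"
    using bij_betw_apply[OF assms] by (auto simp: PiE_iff)
  show "(\<lambda>y. \<lambda>i\<in>I. inv_into (A i) (h i) (y i)) \<in> Pi\<^sub>E I B \<rightarrow> Pi\<^sub>E I A"
    using bij_betw_apply[OF bij_betw_inv_into[OF assms]] by (auto simp: PiE_iff)
  show "(\<lambda>i\<in>I. inv_into (A i) (h i) ((\<lambda>i\<in>I. h i (x i)) i)) = x" if "x \<in> Pi\<^sub>E I A" for x
    by (rule extensionalityI[OF restrict_extensional, of _ I])
      (use that bij_betw_inv_into_left[OF assms] in \<open>auto simp: PiE_iff\<close>)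
  show "(\<lambda>i\<in>I. h i ((\<lambda>i\<in>I. inv_into (A i) (h i) (y i)) i)) = y" if "y \<in> Pi\<^sub>E I B" for y
    by (rule extensionalityI[OF restrict_extensional, of _ I])
      (use that bij_betw_inv_into_right[OF assms] in \<open>auto simp: PiE_iff\<close>)
qed


section \<open>The bijection\<close>

lemma residue_eq_iff: "residue n i = residue n j \<longleftrightarrow> i mod int n = j mod int n"
  by (simp add: residue_def mod_eq_dvd_iff)

lemma residue_lift_eq:
  assumes "set c \<subseteq> {1..int n}"
  shows "residue_lift n c = {i. residue n i \<in> set c}"
proof -
  have "(\<exists>a \<in> set c. residue n i = residue n a) \<longleftrightarrow> residue n i \<in> set c" for i
    using assms residue_id by (metis subsetD)
  then show ?thesis by (simp add: residue_lift_def flip: residue_eq_iff)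
qed

lemma affine_perm_residue:
  assumes "affine_perm n f" "0 < n"
  shows "residue n (f i) = reduction n f (residue n i)"
proof -
  define k where "k = - ((i - 1) div int n)"
  have "f (i + k * int n) = f i + k * int n"
    using periodic_mult[of "\<lambda>i. f i - i" n i k] assms(1) by (simp add: affine_perm_def)
  then have "f (residue n i) = f i + k * int n" by (simp add: residue_eq k_def)
  then show ?thesis by (simp add: reduction_eq[OF residue_in[OF assms(2)]] residue_shift)
qed

lemma cycle_decomposition_disjoint:
  assumes "is_cycle_decomposition n g cs" "c \<in> set cs" "d \<in> set cs" "x \<in> set c" "x \<in> set d"
  shows "c = d"
  using assms unfolding is_cycle_decomposition_def distinct_concat_iff by blast

lemma cycle_decomposition_invariant:
  assumes "is_cycle_decomposition n g cs" "c \<in> set cs" "x \<in> {1..int n}"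
  shows "g x \<in> set c \<longleftrightarrow> x \<in> set c"
proof -
  have "x \<in> set (concat cs)" using assms(1,3) unfolding is_cycle_decomposition_def by metis
  then obtain d where d: "d \<in> set cs" "x \<in> set d" by auto
  then have "g x \<in> set d" using orbit_cycle_decomposition[OF assms(1) d] orbit.base by metis
  with cycle_decomposition_disjoint[OF assms(1,2) d(1)] d(2) show ?thesis by blast
qed

section \<open>Restriction of an affine permutation to an invariant set\<close>

context periodic_subset
begin

context
  fixes f g :: "int \<Rightarrow> int"
  assumes f: "affine_perm n f" and f_S: "\<And>i. f i \<in> S \<longleftrightarrow> i \<in> S" and g: "\<And>a. \<phi> (g a) = f (\<phi> a)"
begin

lemma affine_perm_restrict: "affine_perm m g"
  unfolding affine_perm_def
proof (intro conjI allI bijI)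
  have "inj f" "surj f" using f by (auto simp: affine_perm_def bij_def)
  show "inj g"
  proof (rule injI)
    fix a b assume "g a = g b"
    then have "f (\<phi> a) = f (\<phi> b)" by (metis g)
    with \<open>inj f\<close> show "a = b" by (simp add: inj_eq)
  qed
  show "surj g"
    unfolding surj_def
  proof
    fix b
    from \<open>surj f\<close> obtain i where i: "\<phi> b = f i" by (metis surjD)
    then have "i \<in> S" using f_S[of i] in_S[of b] by simp
    then obtain a where "i = \<phi> a" by (rule S_E)
    with i g have "\<phi> b = \<phi> (g a)" by simp
    then show "\<exists>a. b = g a" by auto
  qed
  fix a
  have "\<phi> (g (a + int m)) = \<phi> (g a + int m)"
    using f by (simp add: g shift affine_perm_def)
  then show "g (a + int m) = g a + int m" by simp
qed

lemma bounds_restrict: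
  assumes "\<And>i. i \<le> f i \<and> f i \<le> i + int n"
  shows "a \<le> g a \<and> g a \<le> a + int m"
  using assms[of "\<phi> a"] by (simp flip: g shift)

text \<open>On representatives \<open>\<phi>\<close> intertwines the two reductions, so a single
  orbit on \<open>S \<inter> {1..n}\<close> comes from a single orbit on
  \<open>{1..m}\<close>.\<close>

lemma num_cycles_restrict:
  assumes "\<And>i. i \<in> S \<inter> {1..int n} \<Longrightarrow> orbit (reduction n f) i = S \<inter> {1..int n}"
  shows "num_cycles m (reduction m g) = 1"
proof -
  have red: "reduction m g b \<in> {1..int m} \<and> \<phi> (reduction m g b) = reduction n f (\<phi> b)"
    if b: "b \<in> {1..int m}" for b
    using residue_in[OF pos(2)] b in_fundamental_iff[of b]
    by (simp add: reduction_eq residue_index g)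
  have "orbit (reduction m g) a = {1..int m}" if a: "a \<in> {1..int m}" for a
  proof (intro equalityI subsetI)
    fix b assume "b \<in> orbit (reduction m g) a"
    then show "b \<in> {1..int m}" by induction (use red a in blast)+
  next
    fix b assume "b \<in> {1..int m}"
    then have "\<phi> b \<in> orbit (reduction n f) (\<phi> a)"
      using assms[of "\<phi> a"] a in_fundamental_iff by simp
    then obtain b' where "b' \<in> orbit (reduction m g) a" "\<phi> b = \<phi> b'"
    proof (induction "\<phi> b" arbitrary: b thesis)
      case base
      then show ?case using red[OF a] by (metis eq_iff orbit.base)
    next
      case (step z)
      \<comment> \<open>A second induction along the orbit, which also records
        \<open>{1..m}\<close>: \<open>red\<close> is available only there.\<close>
      have "\<exists>b'. b' \<in> orbit (reduction m g) a \<and> b' \<in> {1..int m} \<and> z = \<phi> b'"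
        using step(1)
      proof induction
        case base
        show ?case using red[OF a] orbit.base by metis
      next
        case (step z)
        then show ?case using red orbit.step by metis
      qed
      with step red show ?case by (metis eq_iff orbit.step)
    qed
    then show "b \<in> orbit (reduction m g) a" by simp
  qed
  then have "orbit (reduction m g) ` {1..int m} = (\<lambda>_. {1..int m}) ` {1..int m}"
    by (rule image_cong[OF refl])
  with pos(2) show ?thesis by (simp add: num_cycles_def image_constant_conv)
qed

end

end

theorem theorem1p2:
  fixes n k :: nat
    and f :: "int \<Rightarrow> int"
    and P :: "step list"
    and cs :: "int list list"
  assumes "1 \<le> n" and "k \<le> n"
    and "f \<in> bounded_affine_perms k n"
    and "P \<in> lattice_paths k n"
    and "is_cycle_decomposition n (reduction n f) cs"
  shows "let r = length cs;
             nj = (\<lambda>j. length (cs ! j));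
             S = (\<lambda>j. residue_lift n (cs ! j));
             fj = (\<lambda>j. restrict_perm (S j) f);
             Pj = (\<lambda>j. restrict_path (S j) P)
         in \<exists>kj :: nat \<Rightarrow> nat.
              (\<forall>j<r. real (kj j) = av (nj j) (fj j)) \<and>
              (\<forall>j<r. fj j \<in> bounded_affine_perms (kj j) (nj j)) \<and>
              ((\<exists>j<r. Pj j \<notin> lattice_paths (kj j) (nj j)) \<longrightarrow> Deo_max f P = {}) \<and>
              (\<not> (\<exists>j<r. Pj j \<notin> lattice_paths (kj j) (nj j)) \<longrightarrow>
                 (\<exists>\<Phi>. bij_betw \<Phi> (Deo_max f P) (\<Pi>\<^sub>E j\<in>{..<r}. Deo_max (fj j) (Pj j))))"
proof -
  define r where "r = length cs"
  define m where "m j = length (cs ! j)" for j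
  define S where "S j = residue_lift n (cs ! j)" for j
  define g where "g j = restrict_perm (S j) f" for j
  define Q where "Q j = restrict_path (S j) P" for j
  define \<phi> where "\<phi> j = order_index (S j)" for j
  note cd = assms(5)
  have n: "0 < n" and P: "length P = n"
    and f: "affine_perm n f" and f_bounds: "\<And>i. i \<le> f i \<and> f i \<le> i + int n"
    using assms by (auto simp: lattice_paths_def bounded_affine_perms_def)
  have cs: "\<forall>c \<in> set cs. c \<noteq> []" "distinct (concat cs)" "set (concat cs) = {1..int n}"
    using cd by (simp_all add: is_cycle_decomposition_def)
  have "distinct cs" using cs by (auto simp: distinct_concat_iff)
  have nth: "cs ! j \<in> set cs" "set (cs ! j) \<subseteq> {1..int n}" if "j < r" for j
    using that cs(3) nth_mem[of j cs] by (auto simp: r_def)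
  have S: "S j = {i. residue n i \<in> set (cs ! j)}" if "j < r" for j
    unfolding S_def by (rule residue_lift_eq[OF nth(2)[OF that]])
  have S_n: "S j \<inter> {1..int n} = set (cs ! j)" if "j < r" for j
    using nth[OF that] by (auto simp: S[OF that] residue_id)
  have card: "card (S j \<inter> {1..int n}) = m j" if "j < r" for j
    using cs(2) nth(1)[OF that] by (simp add: S_n[OF that] m_def distinct_card distinct_concat_iff)
  have m: "0 < m j" if "j < r" for j
    using cs(1) nth[OF that] by (simp add: m_def)
  have S_shift: "i + int n \<in> S j \<longleftrightarrow> i \<in> S j" if "j < r" for i j
    using residue_shift[of n i 1] by (simp add: S[OF that])
  have index: "periodic_subset n (m j) (\<phi> j) (S j)" if "j < r" for j
    using periodic_subset_order_index[of n "S j", OF S_shift[OF that] n] m[OF that] card[OF that]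
        by (simp add: \<phi>_def)
  have Q: "length (Q j) = m j" "path_step (Q j) = path_step P \<circ> \<phi> j" if "j < r" for j
    using length_restrict_path[of n "S j", OF S_shift[OF that] n] path_step_restrict_path[of n
        "S j", OF S_shift[OF that] n]
      m[OF that] card[OF that] P by (simp_all add: \<phi>_def Q_def)
  have partition: "\<exists>!j. j < r \<and> i \<in> S j" for i
  proof -
    have "residue n i \<in> set (concat cs)" using cs(3) residue_in[OF n] by simp
    then obtain c where "c \<in> set cs" "residue n i \<in> set c" by auto
    then obtain j where "j < r" "residue n i \<in> set (cs ! j)" unfolding r_def
        by (metis in_set_conv_nth)
    then show ?thesis
      using S cycle_decomposition_disjoint[OF cd nth(1) nth(1)] \<open>distinct cs\<close>
      by (intro ex1I[of _ j]) (auto simp: r_def nth_eq_iff_index_eq)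
  qed
  interpret cycle_classes n r m \<phi> S
    by (rule cycle_classes.intro[OF index partition])
  have f_S: "f i \<in> S j \<longleftrightarrow> i \<in> S j" if "j < r" for i j
    using affine_perm_residue[OF f n, of i] cycle_decomposition_invariant[OF cd nth(1)[OF that] residue_in[OF n]]
    by (simp add: S[OF that])
  have g: "\<phi> j (g j a) = f (\<phi> j a)" if j: "j < r" for j a
  proof -
    interpret periodic_subset n "m j" "\<phi> j" "S j" by (rule index[OF j])
    obtain b where "f (\<phi> j a) = \<phi> j b" using f_S[OF j, of "\<phi> j a"] in_S by (metis S_E)
    then show ?thesis by (simp add: g_def restrict_perm_def flip: \<phi>_def)
  qed
  have orbit: "orbit (reduction n f) i = set (cs ! j)" if "j < r" "i \<in> set (cs ! j)" for i j
    by (rule orbit_cycle_decomposition[OF cd nth(1)[OF that(1)] that(2)])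
  have num_g: "num_cycles (m j) (reduction (m j) (g j)) = 1" if "j < r" for j
    by (rule periodic_subset.num_cycles_restrict[OF index[OF that] f f_S[OF that] g[OF that]])
      (simp add: S_n[OF that] orbit[OF that])
  have orbit_S: "\<exists>c<r. i \<in> S c \<and> j \<in> S c"
    if eq: "orbit (reduction n f) (residue n i) = orbit (reduction n f) (residue n j)" for i j
  proof -
    obtain c d where c: "c < r" "i \<in> S c" and d: "d < r" "j \<in> S d" using partition by meson
    have "residue n j \<in> set (cs ! c)"
      using eq orbit[OF c(1), of "residue n i"] orbit[OF d(1), of "residue n j"] c d S by auto
    with c S show ?thesis by auto
  qed
  have bij: "bij_betw (\<lambda>E. \<lambda>j\<in>{..<r}. pull (\<phi> j) E) (maximal_elbow_sets f (path_step P) n)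
      (\<Pi>\<^sub>E j\<in>{..<r}. maximal_elbow_sets (g j) (path_step P \<circ> \<phi> j) (m j))"
    by (rule bij_betw_maximal)
      (use path_step_periodic[of P] P g num_g orbit_S num_cycles_cycle_decomposition[OF cd] in \<open>auto simp: r_def\<close>)
  have Q_nonempty: "Q j \<noteq> []" if "j < r" for j
    using Q(1)[OF that] m[OF that] by auto
  have "bij_betw (inv_into (Deo_max (g j) (Q j)) (elbow_set (Q j)))
      (maximal_elbow_sets (g j) (path_step P \<circ> \<phi> j) (m j)) (Deo_max (g j) (Q j))" if "j \<in> {..<r}" for j
    using bij_betw_inv_into[OF bij_betw_Deo_max[OF Q_nonempty, of j "g j"]] that Q[of j] by simp
  note bij_Q = bij_betw_PiE[of "{..<r}", OF this]
  have "P \<noteq> []" using n P by auto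
  then have "bij_betw (elbow_set P) (Deo_max f P) (maximal_elbow_sets f (path_step P) n)"
    using bij_betw_Deo_max[of P f] P by simp
  \<comment> \<open>Obtained before the case distinction on the heights: case (1) is read off from
    the same bijection.\<close>
  then obtain \<Phi> where \<Phi>: "bij_betw \<Phi> (Deo_max f P) (\<Pi>\<^sub>E j\<in>{..<r}. Deo_max (g j) (Q j))"
    using bij_betw_trans[OF bij_betw_trans[OF _ bij] bij_Q] that by blast
  have "\<exists>k::nat. av (m j) (g j) = real k" if "j < r" for j
    using av_natural[OF periodic_subset.affine_perm_restrict[OF index[OF that] f f_S[OF that] g[OF that]] _ m[OF that]]
      periodic_subset.bounds_restrict[OF index[OF that] f f_S[OF that] g[OF that] f_bounds] by blast
  then obtain kj :: "nat \<Rightarrow> nat" where kj: "\<And>j. j < r \<Longrightarrow> av (m j) (g j) = real (kj j)" by metis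
  have "g j \<in> bounded_affine_perms (kj j) (m j)" if "j < r" for j
    using periodic_subset.affine_perm_restrict[OF index[OF that] f f_S[OF that] g[OF that]]
      periodic_subset.bounds_restrict[OF index[OF that] f f_S[OF that] g[OF that] f_bounds] kj[OF that]
    by (simp add: bounded_affine_perms_def)
  \<comment> \<open>A filling would have a \<open>j\<close>-th component under
    \<open>\<Phi>\<close>, and its strands would force the height of \<open>Q j\<close> to be the
    average \<open>kj j\<close>.\<close>
  moreover have "Deo_max f P = {}" if j: "j < r" "Q j \<notin> lattice_paths (kj j) (m j)" for j
  proof (rule ccontr)
    assume "Deo_max f P \<noteq> {}"
    then obtain F where "F \<in> Deo_max f P" by blast
    with \<Phi> j(1) have "\<Phi> F j \<in> Deo_max (g j) (Q j)" by (auto dest!: bij_betw_apply)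
    then have "Deo_max (g j) (Q j) \<noteq> {}" by blast
    with Deo_max_nonempty_av[OF Q_nonempty[OF j(1)], of "g j"] Q(1)[OF j(1)] kj[OF j(1)]
    have "count_list (Q j) StepU = kj j" by simp
    with Q(1)[OF j(1)] j(2) show False by (simp add: lattice_paths_def)
  qed
  ultimately show ?thesis
    unfolding Let_def r_def[symmetric] m_def[symmetric] S_def[symmetric] g_def[symmetric] Q_def[symmetric]
    using kj \<Phi> by (intro exI[of _ kj]) auto
qed

end
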